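(* Let $\mathcal{H},\mathcal{G},\mathcal{Q},\mathcal{Q}'$ be real Hilbert spaces, $f:\mathcal{H}\times\mathcal{G}\to\mathbb{R}$ a differentiable function such that $f(\cdot,y)$ is convex for all $y\in\mathcal{G}$ and $f(x,\cdot)$ is concave for all $x\in\mathcal{H}$, $\mathcal{X}\subset\mathcal{H}$ and $\mathcal{Y}\subset\mathcal{G}$ nonempty closed convex sets, $K_1:\mathcal{H}\to\mathcal{Q}$ and $K_2:\mathcal{G}\to\mathcal{Q}'$ nonzero linear continuous operators with closed ranges, and $b\in\mathcal{Q}$, $b'\in\mathcal{Q}'$ such that $\{x\in\mathcal{X}:K_1x=b\}\neq\emptyset$ and $\{y\in\mathcal{Y}:K_2y=b'\}\neq\emptyset$. Consider the problem $$(P)\qquad\min_{\{x\in\mathcal{X}:\,K_1x=b\}}\ \max_{\{y\in\mathcal{Y}:\,K_2y=b'\}}f(x,y).$$ Set $\psi_1(x)=\frac12\|K_1x-b\|^2$, $\psi_2(y)=\frac12\|K_2y-b'\|^2$, and $$\bar A(x,y)=N_{\mathcal{X}}(x)\times N_{\mathcal{Y}}(y),\quad \bar B(x,y)=(\nabla\psi_1(x),\nabla\psi_2(y)),\quad \bar C=\operatorname{zer}\bar B,\quad \bar D(x,y)=(\nabla_1f(x,y),-\nabla_2f(x,y)).$$ Suppose that $\bar A$ is maximally monotone, $\bar D$ is monotone and $\eta^{-1}$-Lipschitz continuous with $\eta>0$, $\bar B$ is monotone and $\mu^{-1}$-Lipschitz continuous with $\mu^{-1}=\max\{\|K_1\|^2,\|K_2\|^2\}$,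 and $\bar C\neq\emptyset$. Let $(\lambda_n)_{n\ge0}$, $(\beta_n)_{n\ge0}$ be sequences of positive real numbers. Let $x_0=r_{-1}\in\mathcal{H}$, $y_0=s_{-1}\in\mathcal{G}$ and for every $n\ge0$ set $$r_n=\operatorname{proj}_{\mathcal{X}}\big[x_n-\lambda_n\nabla_1f(r_{n-1},s_{n-1})-\lambda_n\beta_nK_1^*(K_1r_{n-1}-b)\big],$$ $$s_n=\operatorname{proj}_{\mathcal{Y}}\big[y_n+\lambda_n\nabla_2f(r_{n-1},s_{n-1})-\lambda_n\beta_nK_2^*(K_2s_{n-1}-b')\big],$$ $$x_{n+1}=\lambda_n\beta_n\big[K_1^*(K_1r_{n-1}-b)-K_1^*(K_1r_n-b)\big]+\lambda_n\nabla_1f(r_{n-1},s_{n-1})-\lambda_n\nabla_1f(r_n,s_n)+r_n,$$ $$y_{n+1}=\lambda_n\beta_n\big[K_2^*(K_2s_{n-1}-b')-K_2^*(K_2s_n-b')\big]+\lambda_n\nabla_2f(r_n,s_n)-\lambda_n\nabla_2f(r_{n-1},s_{n-1})+s_n.$$ Let $z_n=\frac1{\tau_n}\sum_{k=0}^n\lambda_k(x_k,y_k)$ with $\tau_n=\sum_{k=0}^n\lambda_k$. Suppose that: (i) $\bar A+N_{\bar C}$ is maximally monotone and the inclusion $(0,0)\in\bar A(\bar x,\bar y)+N_{\bar C}(\bar x,\bar y)+\bar D(\bar x,\bar y)$ has a solution $(\bar x,\bar y)$; (ii) for $i=1,2$ and every $p_i\in\operatorname{ran}(N_{\operatorname{zer}\psi_i})$,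 $\sum_{n\ge0}\lambda_n\beta_n\Big[\psi_i^*\big(\tfrac{p_i}{\beta_n}\big)-\sigma_{\operatorname{zer}\psi_i}\big(\tfrac{p_i}{\beta_n}\big)\Big]<+\infty$; (iii) $(\lambda_n)_{n\ge0}\in\ell^2\setminus\ell^1$; and $\limsup_{n\to+\infty}\Big(\frac{\lambda_n\beta_n}{\mu}+\frac{\lambda_n}{\eta}\Big)<\frac12$. Then $(z_n)_{n\ge0}$ converges weakly to a saddle point of $(P)$.
   Context: $\nabla_1f$, $\nabla_2f$ are the partial gradients of $f$ with respect to its first and second variables. A saddle point of $(P)$ is a pair $(\bar x,\bar y)$ with $\bar x\in\mathcal{X}$, $K_1\bar x=b$, $\bar y\in\mathcal{Y}$, $K_2\bar y=b'$ such that $f(\bar x,y)\le f(\bar x,\bar y)\le f(x,\bar y)$ for all $x\in\mathcal{X}$ with $K_1x=b$ and all $y\in\mathcal{Y}$ with $K_2y=b'$. $\mathcal{H}\times\mathcal{G}$ carries the product Hilbert structure. $\operatorname{zer}T=\{x:0\in Tx\}$ and $\operatorname{ran}T$ is the range of an operator $T$; $\operatorname{zer}\psi_i=\{x:\psi_i(x)=0\}$. $N_S$ is the normal cone of a closed convex set $S$: $N_S(x)=\{u:\langle y-x,u\rangle\le0\ \forall y\in S\}$ if $x\in S$, and $\emptyset$ otherwise. $\sigma_S(u)=\sup_{y\in S}\langle y,u\rangle$ is the support function, $\psi^*(u)=\sup_x\{\langle u,x\rangle-\psi(x)\}$ the Fenchel conjugate, $\operatorname{proj}_S$ the metric projection onto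 $S$, and $K^*$ the adjoint of $K$. *)

theory Defs
  imports "HOL-Analysis.Analysis" "HOL-Library.Set_Algebras"
begin

text \<open>
  A real Hilbert space is a type of sort \<open>{real_inner, complete_space}\<close>; the product type carries
  the product inner product. A set-valued operator is a function \<open>'a \<Rightarrow> 'a set\<close>, and a
  single-valued map \<open>T\<close> is regarded as the operator \<open>\<lambda>x. {T x}\<close>. The pointwise sum of operators
  uses the Minkowski sum from \<open>HOL-Library.Set_Algebras\<close>.
\<close>

definition grad :: "('a::real_inner \<Rightarrow> real) \<Rightarrow> 'a \<Rightarrow> 'a" where
  "grad f x = (THE g. GDERIV f x :> g)"

definition grad1 :: "('a::real_inner \<times> 'b::real_inner \<Rightarrow> real) \<Rightarrow> 'a \<Rightarrow> 'b \<Rightarrow> 'a" where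
  "grad1 f x y = grad (\<lambda>x'. f (x', y)) x"

definition grad2 :: "('a::real_inner \<times> 'b::real_inner \<Rightarrow> real) \<Rightarrow> 'a \<Rightarrow> 'b \<Rightarrow> 'b" where
  "grad2 f x y = grad (\<lambda>y'. f (x, y')) y"

definition monotone_operator :: "('a::real_inner \<Rightarrow> 'a set) \<Rightarrow> bool" where
  "monotone_operator T \<longleftrightarrow>
     (\<forall>x y u v. u \<in> T x \<longrightarrow> v \<in> T y \<longrightarrow> 0 \<le> inner (x - y) (u - v))"

definition maximally_monotone :: "('a::real_inner \<Rightarrow> 'a set) \<Rightarrow> bool" where
  "maximally_monotone T \<longleftrightarrow>
     monotone_operator T \<and>
     (\<forall>S. monotone_operator S \<longrightarrow> (\<forall>x. T x \<subseteq> S x) \<longrightarrow> S = T)"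

definition zer_op :: "('a \<Rightarrow> 'b::zero set) \<Rightarrow> 'a set" where
  "zer_op T = {x. 0 \<in> T x}"

definition ran_op :: "('a \<Rightarrow> 'b set) \<Rightarrow> 'b set" where
  "ran_op T = (\<Union>x. T x)"

definition normal_cone :: "'a::real_inner set \<Rightarrow> 'a \<Rightarrow> 'a set" where
  "normal_cone S x = (if x \<in> S then {u. \<forall>y\<in>S. inner (y - x) u \<le> 0} else {})"

definition support_function :: "'a::real_inner set \<Rightarrow> 'a \<Rightarrow> ereal" where
  "support_function S u = (SUP y\<in>S. ereal (inner y u))"

definition fenchel_conjugate :: "('a::real_inner \<Rightarrow> real) \<Rightarrow> 'a \<Rightarrow> ereal" where
  "fenchel_conjugate \<psi> u = (SUP x. ereal (inner u x - \<psi> x))"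

text \<open>
  The library's \<open>closest_point\<close> is restricted to \<open>heine_borel\<close>, that is, finite-dimensional, spaces.
\<close>

definition proj :: "'a::real_inner set \<Rightarrow> 'a \<Rightarrow> 'a" where
  "proj S x = (THE p. p \<in> S \<and> (\<forall>y\<in>S. dist x p \<le> dist x y))"

definition saddle_point ::
  "('a \<times> 'b \<Rightarrow> real) \<Rightarrow> 'a set \<Rightarrow> 'b set \<Rightarrow> 'a \<Rightarrow> 'b \<Rightarrow> bool" where
  "saddle_point f S T x\<^sub>0 y\<^sub>0 \<longleftrightarrow>
     x\<^sub>0 \<in> S \<and> y\<^sub>0 \<in> T \<and>
     (\<forall>x\<in>S. \<forall>y\<in>T. f (x\<^sub>0, y) \<le> f (x\<^sub>0, y\<^sub>0) \<and> f (x\<^sub>0, y\<^sub>0) \<le> f (x, y\<^sub>0))"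

definition weakly_converges :: "(nat \<Rightarrow> 'a::real_inner) \<Rightarrow> 'a \<Rightarrow> bool" where
  "weakly_converges z l \<longleftrightarrow> (\<forall>u. (\<lambda>n. inner (z n) u) \<longlonglongrightarrow> inner l u)"

end

theory Submission
  imports Defs
begin

text \<open>
  Put \<open>S = X \<times> Y\<close> and \<open>E = S \<inter> C\<close>. Maximality of \<open>A + N\<^sub>C\<close> forces it to equal \<open>N\<^sub>E\<close>. For
  \<open>g = v + p + D u\<close> with \<open>v \<in> N\<^sub>S u\<close>, \<open>p \<in> N\<^sub>C u\<close>, monotonicity and the Fenchel inequality for
  \<open>\<psi>\<close> show that \<open>norm (w n - u)\<^sup>2\<close>, corrected by a term that the step size restriction lets one absorb,
  increases by at most \<open>2 * lam n * inner g (u - P (Suc n))\<close> plus a summable error. If \<open>g = 0\<close>, that is,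
  \<open>u\<close> is a solution, then \<open>norm (w n - u)\<close> converges. For general \<open>g\<close>, summing and dividing by the
  total weight shows that every weak cluster point \<open>l\<close> of the averages satisfies
  \<open>0 \<le> inner g (u - l)\<close>; projecting \<open>l\<close> onto \<open>E\<close> gives \<open>l \<in> E\<close>, and Minty's argument makes \<open>l\<close> a
  solution. If \<open>l\<close> and \<open>l'\<close> are two such cluster points, \<open>inner (w n) (l - l')\<close> converges, hence so do
  its averages, and \<open>l = l'\<close> (Opial-Passty). By convexity and concavity of \<open>f\<close>, solutions are saddle
  points.
\<close>

section \<open>Projections, duality and weak cluster points in Hilbert spaces\<close>

text \<open>Let t tend to 0 from the right. This extracts first-order conditions from inequalities
  along a segment, and from inequalities for all large multiples of a normal vector.\<close>

lemma nonpos_if_le_small_multiples: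
  fixes a c :: real
  assumes "\<And>t. 0 < t \<Longrightarrow> t \<le> 1 \<Longrightarrow> a \<le> t * c"
  shows "a \<le> 0"
proof -
  have "((\<lambda>t. t * c) \<longlongrightarrow> 0 * c) (at_right 0)"
    by (intro tendsto_intros)
  moreover have "\<forall>\<^sub>F t in at_right 0. a \<le> t * c"
    using assms by (auto simp: eventually_at_right_field intro!: exI[of _ 1])
  ultimately show ?thesis
    using tendsto_lowerbound[of "\<lambda>t. t * c" 0 "at_right 0" a] by simp
qed

text \<open>It serves twice: with the midpoint in a convex set it makes minimizing sequences Cauchy,
  and without its last term it bounds the increments of \<open>P\<close> in
  \<open>lyapunov_step\<close>.\<close>

lemma parallelogram_midpoint:
  fixes x u v :: "'a::real_inner"
  shows "(norm (u - v))\<^sup>2 = 2 * (norm (x - u))\<^sup>2 + 2 * (norm (x - v))\<^sup>2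
           - 4 * (norm (x - ((1/2) *\<^sub>R u + (1/2) *\<^sub>R v)))\<^sup>2"
proof -
  define p q where "p = x - u" and "q = x - v"
  have "x - ((1/2) *\<^sub>R u + (1/2) *\<^sub>R v) = (1/2) *\<^sub>R (p + q)"
    by (simp add: p_def q_def scaleR_add_right scaleR_diff_right scaleR_half_double
        flip: scaleR_2)
  moreover have "u - v = q - p"
    by (simp add: p_def q_def)
  moreover have "(norm (q - p))\<^sup>2 = 2 * (norm p)\<^sup>2 + 2 * (norm q)\<^sup>2 - (norm (p + q))\<^sup>2"
    unfolding power2_norm_eq_inner
    by (simp add: inner_add_left inner_add_right inner_diff_left inner_diff_right inner_commute)
  ultimately show ?thesis
    by (simp add: p_def q_def power_divide)
qed

lemma norm_sq_diff_scaleR: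
  fixes p q :: "'a::real_inner"
  shows "(norm (p - t *\<^sub>R q))\<^sup>2 = (norm p)\<^sup>2 - t * (2 * inner p q - t * (norm q)\<^sup>2)"
  unfolding power2_norm_eq_inner
  by (simp add: inner_diff_left inner_diff_right inner_commute[of q p] right_diff_distrib)

text \<open>A minimizing sequence is Cauchy, because the midpoint of two members lies in
  \<open>S\<close> and cannot beat the infimum. Completeness and closedness then supply the
  minimizer.\<close>

lemma nearest_point_exists:
  fixes S :: "'a::{real_inner,complete_space} set"
  assumes "closed S" "convex S" "S \<noteq> {}"
  shows "\<exists>p\<in>S. \<forall>v\<in>S. dist x p \<le> dist x v"
proof -
  define q where "q v = (norm (x - v))\<^sup>2" for v
  define d where "d = (INF v\<in>S. q v)"
  have bdd: "bdd_below (q ` S)"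
    by (rule bdd_belowI[of _ 0]) (auto simp: q_def)
  have d_le: "d \<le> q v" if "v \<in> S" for v
    unfolding d_def using bdd that by (rule cINF_lower)
  have "\<exists>v\<in>S. q v < d + 1 / real (Suc n)" for n
    using cINF_less_iff[OF assms(3) bdd, of "d + 1 / real (Suc n)"] by (simp add: d_def)
  then obtain w where wS: "\<And>n. w n \<in> S" and w: "\<And>n. q (w n) < d + 1 / real (Suc n)"
    by metis
  have sq: "(norm (w m - w n))\<^sup>2 < 2 / real (Suc m) + 2 / real (Suc n)" for m n
  proof -
    have "(1/2) *\<^sub>R w m + (1/2) *\<^sub>R w n \<in> S"
      using assms(2) wS by (intro convexD) auto
    from d_le[OF this] show ?thesis
      using parallelogram_midpoint[of "w m" "w n" x] w[of m] w[of n] unfolding q_def by linarith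
  qed
  have "Cauchy w"
  proof (rule metric_CauchyI)
    fix e :: real
    assume "e > 0"
    then obtain N where N: "4 / e\<^sup>2 < real N"
      using reals_Archimedean2 by blast
    have Npos: "real N > 0"
      using N \<open>e > 0\<close> by (smt (verit) divide_pos_pos zero_less_power)
    have small: "2 / real (Suc m) \<le> e\<^sup>2 / 2" if "m \<ge> N" for m
    proof -
      have "2 / real (Suc m) \<le> 2 / real N"
        using that Npos by (intro divide_left_mono) auto
      also have "\<dots> \<le> e\<^sup>2 / 2"
        using N \<open>e > 0\<close> Npos by (simp add: field_simps)
      finally show ?thesis .
    qed
    have "dist (w m) (w n) < e" if "m \<ge> N" "n \<ge> N" for m n
    proof -
      have "(norm (w m - w n))\<^sup>2 < e\<^sup>2"
        using sq[of m n] small[OF that(1)] small[OF that(2)] by linarith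
      then show ?thesis
        using \<open>e > 0\<close> by (simp add: dist_norm power2_less_imp_less)
    qed
    then show "\<exists>M. \<forall>m\<ge>M. \<forall>n\<ge>M. dist (w m) (w n) < e"
      by blast
  qed
  then obtain p where p: "w \<longlonglongrightarrow> p"
    using Cauchy_convergent convergent_def by blast
  have pS: "p \<in> S"
    using closed_sequentially[OF assms(1) _ p] wS by blast
  have "q p \<le> d"
  proof (rule LIMSEQ_le)
    show "(\<lambda>n. q (w n)) \<longlonglongrightarrow> q p"
      unfolding q_def by (intro tendsto_intros p)
    have "(\<lambda>n. d + 1 / real (Suc n)) \<longlonglongrightarrow> d + 0"
      by (intro tendsto_intros) (use LIMSEQ_inverse_real_of_nat in \<open>simp add: inverse_eq_divide\<close>)
    then show "(\<lambda>n. d + 1 / real (Suc n)) \<longlonglongrightarrow> d" by simp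
    show "\<exists>N. \<forall>n\<ge>N. q (w n) \<le> d + 1 / real (Suc n)"
      using w less_imp_le by blast
  qed
  then have "q p \<le> q v" if "v \<in> S" for v
    using d_le[OF that] by linarith
  then have "\<forall>v\<in>S. dist x p \<le> dist x v"
    by (simp add: q_def dist_norm)
  with pS show ?thesis by blast
qed

text \<open>Moving from \<open>p\<close> a fraction t towards \<open>v\<close> stays in
  \<open>S\<close> and cannot decrease the distance to \<open>x\<close>. Expanding the square and
  dividing by t leaves a remainder of order t.\<close>

lemma nearest_point_obtuse:
  fixes S :: "'a::real_inner set"
  assumes "convex S" "p \<in> S" "\<forall>v\<in>S. dist x p \<le> dist x v" "v \<in> S"
  shows "inner (x - p) (v - p) \<le> 0"
proof -
  have "2 * inner (x - p) (v - p) \<le> 0"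
  proof (rule nonpos_if_le_small_multiples)
    fix t :: real
    assume t: "0 < t" "t \<le> 1"
    have "(1 - t) *\<^sub>R p + t *\<^sub>R v \<in> S"
      using assms t by (intro convexD) auto
    then have "dist x p \<le> norm (x - ((1 - t) *\<^sub>R p + t *\<^sub>R v))"
      using assms(3) by (simp add: dist_norm)
    then have "(norm (x - p))\<^sup>2 \<le> (norm ((x - p) - t *\<^sub>R (v - p)))\<^sup>2"
      by (simp add: dist_norm algebra_simps)
    also have "\<dots> = (norm (x - p))\<^sup>2 - t * (2 * inner (x - p) (v - p) - t * (norm (v - p))\<^sup>2)"
      by (rule norm_sq_diff_scaleR)
    finally show "2 * inner (x - p) (v - p) \<le> t * (norm (v - p))\<^sup>2"
      using t by (smt (verit) mult_pos_pos)
  qed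
  then show ?thesis by simp
qed

text \<open>The description in \<open>proj\<close> is meaningful because nearest points are unique:
  the obtuse angle conditions at two of them add up to
  \<open>inner (q - p) (q - p) \<le> 0\<close>.\<close>

lemma proj_properties:
  fixes S :: "'a::{real_inner,complete_space} set"
  assumes "closed S" "convex S" "S \<noteq> {}"
  shows proj_in: "proj S x \<in> S"
    and proj_obtuse: "v \<in> S \<Longrightarrow> inner (x - proj S x) (v - proj S x) \<le> 0"
proof -
  let ?P = "\<lambda>p. p \<in> S \<and> (\<forall>v\<in>S. dist x p \<le> dist x v)"
  obtain p where p: "?P p"
    using nearest_point_exists[OF assms] by blast
  have "q = p" if q: "?P q" for q
  proof -
    have "inner (x - p) (q - p) \<le> 0" "inner (x - q) (p - q) \<le> 0"
      using nearest_point_obtuse[OF assms(2)] p q by blast+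
    then have "inner (q - p) (q - p) \<le> 0"
      by (simp add: algebra_simps inner_commute)
    then show ?thesis
      by (metis inner_gt_zero_iff eq_iff_diff_eq_0 not_le)
  qed
  with p have eq: "proj S x = p"
    unfolding proj_def by (rule the_equality)
  show "proj S x \<in> S"
    using p eq by simp
  show "inner (x - proj S x) (v - proj S x) \<le> 0" if "v \<in> S"
    using nearest_point_obtuse[OF assms(2) _ _ that, of p x] p unfolding eq by blast
qed

text \<open>The point of the hyperplane f = 1 nearest to 0 is orthogonal to the kernel, so it
  represents f after division by its squared norm.\<close>

lemma riesz_representation:
  fixes f :: "'a::{real_inner,complete_space} \<Rightarrow> real"
  assumes "bounded_linear f"
  obtains v where "\<And>x. f x = inner x v"
proof (cases "\<exists>w. f w \<noteq> 0")
  case False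
  then show ?thesis
    using that[of 0] by auto
next
  case True
  interpret f: bounded_linear f by fact
  define S where "S = {x. f x = 1}"
  obtain w where w: "f w \<noteq> 0"
    using True by blast
  have "closed S"
    unfolding S_def by (intro closed_Collect_eq f.continuous_on continuous_intros)
  moreover have "convex S"
    unfolding S_def convex_def by (auto simp: f.add f.scaleR)
  moreover have "(1 / f w) *\<^sub>R w \<in> S"
    using w by (simp add: S_def f.scaleR)
  ultimately have S: "proj S 0 \<in> S" "\<And>v. v \<in> S \<Longrightarrow> inner (0 - proj S 0) (v - proj S 0) \<le> 0"
    using proj_in proj_obtuse by blast+
  define p where "p = proj S 0"
  have fp: "f p = 1"
    using S(1) by (simp add: p_def S_def)
  \<comment> \<open>The hyperplane contains both \<open>p + h\<close> and \<open>p - h\<close>, and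
    the two obtuse angle conditions bound \<open>inner p h\<close> by 0 from both sides.\<close>
  have ker: "inner p h = 0" if "f h = 0" for h
  proof -
    have "p + h \<in> S" "p - h \<in> S"
      using fp that by (simp_all add: S_def f.add f.diff)
    from S(2)[OF this(1)] S(2)[OF this(2)] show ?thesis
      by (simp add: p_def)
  qed
  have pp: "inner p p \<noteq> 0"
    using fp f.zero by auto
  have "inner p x = f x * inner p p" for x
    using ker[of "x - f x *\<^sub>R p"] fp by (simp add: f.diff f.scaleR inner_diff_right)
  then have "f x = inner p x / inner p p" for x
    using pp by (metis nonzero_mult_div_cancel_right)
  then have "f x = inner x ((1 / inner p p) *\<^sub>R p)" for x
    by (metis inner_commute inner_scaleR_right mult_1 times_divide_eq_left)
  then show ?thesis
    by (rule that)
qed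

text \<open>\<open>adjoint\<close> is defined by choice. Riesz, applied to the functional
  \<open>inner (K u) v\<close> of \<open>u\<close>, shows that a map with the required property
  exists.\<close>

lemma inner_adjoint:
  fixes K :: "'a::{real_inner,complete_space} \<Rightarrow> 'b::real_inner"
  assumes "bounded_linear K"
  shows "inner u (adjoint K v) = inner (K u) v"
proof -
  have "\<exists>w. \<forall>u. inner (K u) v = inner u w" for v
    using riesz_representation[OF bounded_linear_inner_left_comp[OF assms, of v]] by metis
  then obtain K' where K': "\<And>v u. inner (K u) v = inner u (K' v)"
    by metis
  then have "adjoint K = K'"
    by (intro adjoint_unique) auto
  then show ?thesis
    by (simp add: K')
qed

text \<open>Cluster points along filters replace weakly convergent subsequences: the functionals
  \<open>inner (z n)\<close> stay in a product of compact intervals, which is compact by Tychonoff.\<close>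

lemma weak_cluster_point:
  fixes z :: "nat \<Rightarrow> 'a::{real_inner,complete_space}"
  assumes bd: "\<And>n. norm (z n) \<le> M" and F: "F \<noteq> bot"
  obtains F' l where "F' \<le> F" "F' \<noteq> bot" "\<And>u. ((\<lambda>n. inner (z n) u) \<longlongrightarrow> inner l u) F'"
proof -
  define \<Phi> where "\<Phi> n = (\<lambda>u. inner (z n) u)" for n
  define U where "U = (\<Pi>\<^sub>E u\<in>(UNIV :: 'a set). cball (0::real) (M * norm u))"
  have "compact U"
    unfolding U_def
    using compactin_PiE[of "\<lambda>_. euclidean" UNIV "\<lambda>u::'a. cball (0::real) (M * norm u)"]
    by (simp add: euclidean_product_topology)
  have bound: "\<bar>inner (z n) u\<bar> \<le> M * norm u" for n u
    using Cauchy_Schwarz_ineq2[of "z n" u] mult_right_mono[OF bd[of n], of "norm u"] by simp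
  have "eventually (\<lambda>n. \<Phi> n \<in> U) F"
    by (intro always_eventually) (auto simp: U_def \<Phi>_def bound)
  then have "eventually (\<lambda>h. h \<in> U) (filtermap \<Phi> F)"
    by (simp add: eventually_filtermap)
  moreover have "filtermap \<Phi> F \<noteq> bot"
    using F by (simp add: filtermap_bot_iff)
  ultimately obtain g where g: "inf (nhds g) (filtermap \<Phi> F) \<noteq> bot"
    using \<open>compact U\<close>[unfolded compact_filter, rule_format, of "filtermap \<Phi> F"] by blast
  \<comment> \<open>\<open>F'\<close> refines \<open>F\<close> towards the indices whose functionals
    are near the cluster point \<open>g\<close>, so that along it they converge to
    \<open>g\<close>.\<close>
  define F' where "F' = inf F (filtercomap \<Phi> (nhds g))"
  have F'_bot: "F' \<noteq> bot"
  proof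
    assume "F' = bot"
    then have "eventually (\<lambda>_. False) F'" by simp
    then obtain P Q where PQ: "eventually P F" "eventually Q (filtercomap \<Phi> (nhds g))"
      "\<And>x. P x \<Longrightarrow> Q x \<Longrightarrow> False"
      unfolding F'_def eventually_inf by blast
    then obtain R where R: "eventually R (nhds g)" "\<And>x. R (\<Phi> x) \<Longrightarrow> Q x"
      unfolding eventually_filtercomap by blast
    have "eventually (\<lambda>y. \<not> R y) (filtermap \<Phi> F)"
      unfolding eventually_filtermap using PQ(1) by eventually_elim (use PQ R in blast)
    then have "eventually (\<lambda>_. False) (inf (nhds g) (filtermap \<Phi> F))"
      using R(1) unfolding eventually_inf by blast
    then show False
      using g by (simp add: trivial_limit_def)
  qed
  have lim: "((\<lambda>n. inner (z n) u) \<longlongrightarrow> g u) F'" for u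
  proof -
    have "filterlim \<Phi> (nhds g) F'"
      unfolding F'_def filterlim_iff_le_filtercomap by simp
    from continuous_on_tendsto_compose[OF continuous_on_product_coordinates this, of u]
    show ?thesis
      by (simp add: \<Phi>_def)
  qed
  \<comment> \<open>Linearity and the bound \<open>M * norm u\<close> survive pointwise limits, so
    Riesz turns \<open>g\<close> into a vector.\<close>
  have "bounded_linear g"
  proof
    show "g (u + v) = g u + g v" for u v
      using tendsto_unique[OF F'_bot lim[of "u + v"]] tendsto_add[OF lim[of u] lim[of v]]
      by (simp add: inner_add_right)
    show "g (c *\<^sub>R u) = c *\<^sub>R g u" for c u
      using tendsto_unique[OF F'_bot lim[of "c *\<^sub>R u"]] tendsto_mult_left[OF lim[of u]]
      by simp
    have "\<bar>g u\<bar> \<le> M * norm u" for u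
      by (rule tendsto_upperbound[OF tendsto_rabs[OF lim[of u]] _ F'_bot]) (simp add: bound)
    then show "\<exists>K. \<forall>u. norm (g u) \<le> norm u * K"
      by (auto simp: mult.commute intro!: exI[of _ M])
  qed
  then obtain l where l: "\<And>u. g u = inner u l"
    using riesz_representation by blast
  show thesis
  proof
    show "F' \<le> F" by (simp add: F'_def)
    show "F' \<noteq> bot" by fact
    show "((\<lambda>n. inner (z n) u) \<longlongrightarrow> inner l u) F'" for u
      using lim[of u] by (simp add: l inner_commute)
  qed
qed

section \<open>Weighted averages and quasi-Fejer sequences\<close>

text \<open>Toeplitz argument: since the total weight diverges, every initial block of terms gets a
  vanishing share, and the remaining terms are close to \<open>l\<close>.\<close>

lemma weighted_average_tendsto:
  fixes a lam :: "nat \<Rightarrow> real"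
  assumes pos: "\<And>n. lam n > 0" and div: "\<not> summable lam" and a: "a \<longlonglongrightarrow> l"
  shows "(\<lambda>n. (\<Sum>k\<le>n. lam k * a k) / (\<Sum>k\<le>n. lam k)) \<longlonglongrightarrow> l"
proof (rule LIMSEQ_I)
  fix e :: real
  assume "e > 0"
  define \<tau> where "\<tau> n = (\<Sum>k\<le>n. lam k)" for n
  have \<tau>_pos: "\<tau> n > 0" for n
    unfolding \<tau>_def using pos by (intro sum_pos) auto
  obtain N where N: "\<And>k. k \<ge> N \<Longrightarrow> \<bar>a k - l\<bar> < e / 2"
    using LIMSEQ_D[OF a, of "e / 2"] \<open>e > 0\<close> by auto
  define c where "c = (\<Sum>k<N. lam k * \<bar>a k - l\<bar>)"
  \<comment> \<open>If no such index existed, the partial sums of \<open>lam\<close> would be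
    bounded. From \<open>M\<close> on, the head \<open>c\<close> is less than
    \<open>e / 2 * \<tau> n\<close>.\<close>
  obtain M where M: "2 * c / e < \<tau> M"
  proof (rule ccontr)
    assume "\<not> thesis"
    then have le: "\<tau> n \<le> 2 * c / e" for n
      using that not_le by blast
    have "summable lam"
    proof (rule summableI_nonneg_bounded)
      show "0 \<le> lam n" for n
        using pos less_imp_le by blast
      show "sum lam {..<n} \<le> 2 * c / e" for n
        using le[of n] pos[of n] by (simp add: \<tau>_def lessThan_Suc_atMost[symmetric])
    qed
    with div show False by blast
  qed
  have "\<bar>(\<Sum>k\<le>n. lam k * a k) / \<tau> n - l\<bar> < e" if "n \<ge> M" for n
  proof -
    have "\<tau> M \<le> \<tau> n"
      unfolding \<tau>_def using pos that by (intro sum_mono2) (auto intro: less_imp_le)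
    from less_le_trans[OF M this] have cn: "c < e / 2 * \<tau> n"
      using \<open>e > 0\<close> by (simp add: field_simps)
    have "(\<Sum>k\<le>n. lam k * a k) / \<tau> n - l = (\<Sum>k\<le>n. lam k * (a k - l)) / \<tau> n"
      using \<tau>_pos[of n] by (simp add: \<tau>_def right_diff_distrib sum_subtractf
          sum_distrib_right[symmetric] diff_divide_distrib)
    moreover have "\<bar>\<Sum>k\<le>n. lam k * (a k - l)\<bar> \<le> c + e / 2 * \<tau> n"
    proof -
      have "\<bar>\<Sum>k\<le>n. lam k * (a k - l)\<bar> \<le> (\<Sum>k\<le>n. \<bar>lam k * (a k - l)\<bar>)"
        by (rule sum_abs)
      also have "\<dots> \<le> (\<Sum>k\<le>n. (if k < N then lam k * \<bar>a k - l\<bar> else 0) + e / 2 * lam k)"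
      proof (rule sum_mono)
        fix k
        have "\<bar>lam k * (a k - l)\<bar> = lam k * \<bar>a k - l\<bar>"
          using pos[of k] by (simp add: abs_mult)
        moreover have "lam k * \<bar>a k - l\<bar> \<le> e / 2 * lam k" if "\<not> k < N"
          using N[of k] that pos[of k] by (simp add: mult.commute)
        moreover have "0 \<le> e / 2 * lam k"
          using pos[of k] \<open>e > 0\<close> by simp
        ultimately show "\<bar>lam k * (a k - l)\<bar>
            \<le> (if k < N then lam k * \<bar>a k - l\<bar> else 0) + e / 2 * lam k"
          by auto
      qed
      also have "\<dots> = (\<Sum>k\<in>{..n} \<inter> {..<N}. lam k * \<bar>a k - l\<bar>) + e / 2 * \<tau> n"
        by (simp add: sum.distrib \<tau>_def sum_distrib_left sum.If_cases lessThan_def)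
      also have "(\<Sum>k\<in>{..n} \<inter> {..<N}. lam k * \<bar>a k - l\<bar>) \<le> c"
        unfolding c_def using pos by (intro sum_mono2) (auto simp: less_imp_le)
      finally show ?thesis by simp
    qed
    ultimately have "\<bar>(\<Sum>k\<le>n. lam k * a k) / \<tau> n - l\<bar> \<le> (c + e / 2 * \<tau> n) / \<tau> n"
      using \<tau>_pos[of n] by (simp add: abs_divide divide_right_mono)
    also have "\<dots> < e"
      using cn \<tau>_pos[of n] by (simp add: field_simps)
    finally show ?thesis .
  qed
  then show "\<exists>no. \<forall>n\<ge>no. norm ((\<Sum>k\<le>n. lam k * a k) / (\<Sum>k\<le>n. lam k) - l) < e"
    by (auto simp: \<tau>_def)
qed

text \<open>Subtracting the partial sums of the errors from \<open>a\<close> leaves a decreasing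
  sequence bounded below. Summing the recursion then bounds the partial sums of
  \<open>c\<close>.\<close>

lemma quasi_fejer:
  fixes a c e :: "nat \<Rightarrow> real"
  assumes nonneg: "\<And>n. 0 \<le> a n" "\<And>n. 0 \<le> c n" "\<And>n. 0 \<le> e n"
    and e: "summable e"
    and step: "\<forall>\<^sub>F n in sequentially. a (Suc n) + c n \<le> a n + e n"
  shows "convergent a" and "summable c"
proof -
  obtain N where N: "\<And>n. n \<ge> N \<Longrightarrow> a (Suc n) + c n \<le> a n + e n"
    using step unfolding eventually_sequentially by blast
  \<comment> \<open>The recursion holds only eventually, so all sequences are shifted to where it
    starts; neither conclusion depends on finitely many terms.\<close>
  define a' c' e' where "a' n = a (n + N)" and "c' n = c (n + N)" and "e' n = e (n + N)" for n
  have e': "summable e'"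
    unfolding e'_def using e by (simp add: summable_iff_shift)
  have e'_nonneg: "0 \<le> e' n" for n
    by (simp add: e'_def nonneg)
  have step': "a' (Suc n) + c' n \<le> a' n + e' n" for n
    using N[of "n + N"] by (simp add: a'_def c'_def e'_def)
  have c'_nonneg: "0 \<le> c' n" for n
    by (simp add: c'_def nonneg)
  have a'_nonneg: "0 \<le> a' n" for n
    by (simp add: a'_def nonneg)
  have bound: "sum e' {..<n} \<le> suminf e'" for n
    using sum_le_suminf[OF e', of "{..<n}"] e'_nonneg by simp
  define T where "T n = a' n - sum e' {..<n}" for n
  have "decseq T"
    unfolding decseq_Suc_iff T_def using step' c'_nonneg by (simp add: algebra_simps) (smt (verit))
  moreover have "- suminf e' \<le> T n" for n
    using bound[of n] a'_nonneg[of n] by (simp add: T_def)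
  ultimately have "convergent T"
    using decseq_convergent convergent_def by metis
  then have "convergent (\<lambda>n. T n + sum e' {..<n})"
    using e' by (intro convergent_add) (simp_all add: summable_iff_convergent)
  then have "convergent a'"
    by (simp add: T_def)
  then show "convergent a"
    unfolding a'_def using convergent_ignore_initial_segment by metis
  have "a' n + sum c' {..<n} \<le> a' 0 + sum e' {..<n}" for n
  proof (induction n)
    case (Suc n)
    then show ?case using step'[of n] by simp
  qed simp
  from this[of n for n] bound a'_nonneg have "sum c' {..<n} \<le> a' 0 + suminf e'" for n
    by (meson add_increasing add_left_mono order_trans order_refl)
  then have "summable c'"
    using c'_nonneg by (intro summableI_nonneg_bounded) auto
  then show "summable c"
    unfolding c'_def by (simp add: summable_iff_shift)
qed

section \<open>Extrapolated projection steps with penalization\<close>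

lemma normal_cone_scaleR:
  assumes "v \<in> normal_cone S u" "0 \<le> t"
  shows "t *\<^sub>R v \<in> normal_cone S u"
  using assms by (auto simp: normal_cone_def mult_nonneg_nonpos split: if_splits)

text \<open>It converts a lower bound on \<open>inner (w - w') (p - u)\<close>, which a projection
  step provides, into a decrease of the squared distance to \<open>u\<close>.\<close>

lemma three_point_identity:
  fixes w w' p u :: "'a::real_inner"
  shows "(norm (w - u))\<^sup>2 - (norm (w' - u))\<^sup>2
    = (norm (w - p))\<^sup>2 - (norm (w' - p))\<^sup>2 + 2 * inner (w - w') (p - u)"
  unfolding power2_norm_eq_inner
  by (simp add: inner_diff_left inner_diff_right inner_commute)

text \<open>\<open>P n\<close> is the extrapolation point entering step \<open>n\<close>: in the notation of the statement
  \<open>P n = (r\<^sub>n\<^sub>-\<^sub>1, s\<^sub>n\<^sub>-\<^sub>1)\<close>, while \<open>w n = (x\<^sub>n, y\<^sub>n)\<close>.\<close>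

locale penalty_iteration =
  fixes S C :: "'a::{real_inner,complete_space} set"
    and B D :: "'a \<Rightarrow> 'a" and \<psi> :: "'a \<Rightarrow> real"
    and LB LD \<theta> :: real and lam \<beta> :: "nat \<Rightarrow> real"
    and P w :: "nat \<Rightarrow> 'a"
  assumes feasible_closed: "closed (S \<inter> C)" and feasible_convex: "convex (S \<inter> C)"
    and D_monotone: "\<And>u v. 0 \<le> inner (u - v) (D u - D v)"
    and D_lipschitz: "LD-lipschitz_on UNIV D" and B_lipschitz: "LB-lipschitz_on UNIV B"
    and penalty_le: "\<And>u q. u \<in> C \<Longrightarrow> \<psi> q \<le> inner (B q) (q - u)"
    and lam_pos: "\<And>n. lam n > 0" and \<beta>_pos: "\<And>n. \<beta> n > 0" and lam_div: "\<not> summable lam"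
    and P_in: "\<And>n. P (Suc n) \<in> S"
    and P_obtuse: "\<And>n q. q \<in> S \<Longrightarrow>
      inner (w n - lam n *\<^sub>R (D (P n) + \<beta> n *\<^sub>R B (P n)) - P (Suc n)) (q - P (Suc n)) \<le> 0"
    and w_Suc: "\<And>n. w (Suc n) = P (Suc n) + lam n *\<^sub>R (D (P n) + \<beta> n *\<^sub>R B (P n))
      - lam n *\<^sub>R (D (P (Suc n)) + \<beta> n *\<^sub>R B (P (Suc n)))"
    and step_size: "\<forall>\<^sub>F n in sequentially. lam n * (\<beta> n * LB + LD) \<le> \<theta>"
    and \<theta>_bounds: "0 \<le> \<theta>" "\<theta> < 1 / 2"
    and penalty_summable: "\<And>u p. p \<in> normal_cone C u \<Longrightarrow>
      \<exists>e. summable e \<and> (\<forall>n. 0 \<le> e n) \<and> (\<forall>n q. lam n * (inner p (q - u) - \<beta> n * \<psi> q) \<le> e n)"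
    and normal_cone_feasible: "\<And>u g. g \<in> normal_cone (S \<inter> C) u \<Longrightarrow>
      \<exists>v\<in>normal_cone S u. \<exists>p\<in>normal_cone C u. g = v + p"
    and solvable: "\<exists>u. - D u \<in> normal_cone (S \<inter> C) u"
begin

section \<open>Energy estimate and asymptotic regularity\<close>

definition solutions :: "'a set" where
  "solutions = {u. - D u \<in> normal_cone (S \<inter> C) u}"

text \<open>Fejer monotonicity of \<open>norm (w n - u)\<close> can fail because the forward step is evaluated at the old
  point \<open>P n\<close>. The second term pays for this: it is at most \<open>\<theta>\<^sup>2\<close> times the previous squared increment
  of \<open>P\<close>, and each step gains half of the current one, so the balance is positive for \<open>\<theta> < 1/2\<close>.\<close>

definition lyapunov :: "'a \<Rightarrow> nat \<Rightarrow> real" where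
  "lyapunov u n = (norm (w n - u))\<^sup>2 + (norm (w n - P n))\<^sup>2"

definition avg :: "nat \<Rightarrow> 'a" where
  "avg n = (1 / (\<Sum>k\<le>n. lam k)) *\<^sub>R (\<Sum>k\<le>n. lam k *\<^sub>R w k)"

text \<open>The correction is \<open>lam n\<close> times the change of the operator D +
  \<open>\<beta> n\<close> B between \<open>P n\<close> and \<open>P (Suc n)\<close>, up to sign, so
  the two Lipschitz constants combine into the step size quantity.\<close>

lemma correction_le:
  assumes "lam n * (\<beta> n * LB + LD) \<le> \<theta>"
  shows "norm (w (Suc n) - P (Suc n)) \<le> \<theta> * norm (P (Suc n) - P n)"
proof -
  have "w (Suc n) - P (Suc n)
      = lam n *\<^sub>R ((D (P n) - D (P (Suc n))) + \<beta> n *\<^sub>R (B (P n) - B (P (Suc n))))"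
    by (simp add: w_Suc algebra_simps)
  then have "norm (w (Suc n) - P (Suc n))
      = lam n * norm ((D (P n) - D (P (Suc n))) + \<beta> n *\<^sub>R (B (P n) - B (P (Suc n))))"
    using lam_pos[of n] by simp
  also have "\<dots> \<le> lam n * (LD * norm (P (Suc n) - P n) + \<beta> n * (LB * norm (P (Suc n) - P n)))"
  proof -
    have "norm (D (P n) - D (P (Suc n))) \<le> LD * norm (P (Suc n) - P n)"
      using lipschitz_onD[OF D_lipschitz, of "P n" "P (Suc n)"]
      by (simp add: dist_norm norm_minus_commute)
    moreover have "norm (\<beta> n *\<^sub>R (B (P n) - B (P (Suc n)))) \<le> \<beta> n * (LB * norm (P (Suc n) - P n))"
      using lipschitz_onD[OF B_lipschitz, of "P n" "P (Suc n)"] \<beta>_pos[of n]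
      by (simp add: dist_norm norm_minus_commute)
    ultimately show ?thesis
      using lam_pos[of n] by (intro mult_left_mono norm_triangle_le add_mono) auto
  qed
  also have "\<dots> = lam n * (\<beta> n * LB + LD) * norm (P (Suc n) - P n)"
    by (simp add: algebra_simps)
  also have "\<dots> \<le> \<theta> * norm (P (Suc n) - P n)"
    using assms by (intro mult_right_mono) auto
  finally show ?thesis .
qed

text \<open>The projection inequality is tested at \<open>u\<close>, which need not be a solution.
  The vector \<open>v + p + D u\<close> measures its failure to be one and is kept for the ergodic
  estimate.\<close>

lemma lyapunov_step:
  assumes n: "lam n * (\<beta> n * LB + LD) \<le> \<theta>"
    and v: "v \<in> normal_cone S u" and u: "u \<in> C"
    and e: "\<And>q. lam n * (inner p (q - u) - \<beta> n * \<psi> q) \<le> e"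
  shows "lyapunov u (Suc n) + (1 / 2 - 2 * \<theta>\<^sup>2) * (norm (P (Suc n) - P n))\<^sup>2
    \<le> lyapunov u n + 2 * (lam n * inner (v + p + D u) (u - P (Suc n))) + 2 * e"
proof -
  let ?p = "P (Suc n)" and ?w = "w (Suc n)"
  have "u \<in> S" and vS: "inner (?p - u) v \<le> 0"
    using v P_in[of n] by (auto simp: normal_cone_def split: if_splits)
  \<comment> \<open>\<open>w (Suc n)\<close> trades the forward step at the old point for one at
    \<open>?p\<close>, where monotonicity applies.\<close>
  have eq: "w n - lam n *\<^sub>R (D (P n) + \<beta> n *\<^sub>R B (P n)) - ?p
      = (w n - ?w) - lam n *\<^sub>R (D ?p + \<beta> n *\<^sub>R B ?p)"
    by (simp add: w_Suc)
  have "0 \<le> inner ((w n - ?w) - lam n *\<^sub>R (D ?p + \<beta> n *\<^sub>R B ?p)) (?p - u)"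
    using P_obtuse[OF \<open>u \<in> S\<close>, of n] unfolding eq
    by (metis inner_minus_right minus_diff_eq neg_0_le_iff_le)
  then have 1: "lam n * (inner (D ?p) (?p - u) + \<beta> n * inner (B ?p) (?p - u))
      \<le> inner (w n - ?w) (?p - u)"
    by (simp add: inner_diff_left[of "w n - ?w"] inner_add_left)
  \<comment> \<open>Monotonicity moves \<open>D\<close> from \<open>?p\<close> to \<open>u\<close>,
    \<open>penalty_le\<close> replaces \<open>B\<close> by \<open>\<psi>\<close>, and
    \<open>v\<close> pairs nonpositively with \<open>?p - u\<close>. The vector \<open>p\<close> is
    added and subtracted, so that \<open>e\<close> absorbs its pairing together with the
    penalty.\<close>
  have "inner (D u) (?p - u) \<le> inner (D ?p) (?p - u)"
    using D_monotone[of ?p u] by (simp add: inner_diff_right inner_diff_left inner_commute)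
  moreover have "\<beta> n * \<psi> ?p \<le> \<beta> n * inner (B ?p) (?p - u)"
    using penalty_le[OF u] \<beta>_pos[of n] by (intro mult_left_mono) auto
  moreover have "inner v (?p - u) \<le> 0"
    using vS by (simp add: inner_commute)
  ultimately have "inner (v + p + D u) (?p - u) - (inner p (?p - u) - \<beta> n * \<psi> ?p)
      \<le> inner (D ?p) (?p - u) + \<beta> n * inner (B ?p) (?p - u)"
    by (simp add: inner_add_left)
  from mult_left_mono[OF this, of "lam n"]
  have "lam n * inner (v + p + D u) (?p - u) - lam n * (inner p (?p - u) - \<beta> n * \<psi> ?p)
      \<le> lam n * (inner (D ?p) (?p - u) + \<beta> n * inner (B ?p) (?p - u))"
    using lam_pos[of n] by (simp add: right_diff_distrib)
  with 1 e[of ?p] have 2: "lam n * inner (v + p + D u) (?p - u) - e \<le> inner (w n - ?w) (?p - u)"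
    by linarith
  have 3: "inner (v + p + D u) (?p - u) = - inner (v + p + D u) (u - ?p)"
    by (metis inner_minus_right minus_diff_eq)
  \<comment> \<open>The gain \<open>(norm (w n - ?p))\<^sup>2\<close> is at least half the squared
    increment minus the old correction stored in \<open>lyapunov u n\<close>. The new correction is
    paid twice, in the three-point identity and in \<open>lyapunov u (Suc n)\<close>, hence the loss
    \<open>2 * \<theta>\<^sup>2\<close>.\<close>
  have "(norm (?p - P n))\<^sup>2 \<le> 2 * (norm (w n - P n))\<^sup>2 + 2 * (norm (w n - ?p))\<^sup>2"
    using parallelogram_midpoint[of ?p "P n" "w n"] by (simp add: add.commute)
  moreover have "(norm (?w - ?p))\<^sup>2 \<le> \<theta>\<^sup>2 * (norm (?p - P n))\<^sup>2"
    using power_mono[OF correction_le[OF n], of 2] by (simp add: power_mult_distrib)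
  ultimately show ?thesis
    using three_point_identity[of "w n" u ?w ?p] 2
    unfolding lyapunov_def 3 left_diff_distrib by linarith
qed

text \<open>The threshold 1/2 on the step sizes enters here.\<close>

lemma penalty_coeff_pos: "0 < 1 / 2 - 2 * \<theta>\<^sup>2"
proof -
  have "\<theta>\<^sup>2 < (1 / 2)\<^sup>2"
    using \<theta>_bounds by (intro power_strict_mono) auto
  then show ?thesis by (simp add: power2_eq_square)
qed

text \<open>At a solution the linear term in \<open>lyapunov_step\<close> can be made to
  vanish.\<close>

lemma solutions_decompose:
  assumes "u \<in> solutions"
  obtains v p where "v \<in> normal_cone S u" "p \<in> normal_cone C u" "v + p + D u = 0" "u \<in> C"
proof -
  have "- D u \<in> normal_cone (S \<inter> C) u"
    using assms by (simp add: solutions_def)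
  then obtain v p where "v \<in> normal_cone S u" "p \<in> normal_cone C u" "- D u = v + p"
    using normal_cone_feasible by blast
  moreover from this(2) have "u \<in> C"
    by (auto simp: normal_cone_def split: if_splits)
  ultimately show thesis
    using that by (metis neg_eq_iff_add_eq_0 add.commute add.right_inverse)
qed

text \<open>With the linear term gone, \<open>lyapunov_step\<close> is a quasi-Fejer recursion with
  summable errors, in which the squared increments are the gains.\<close>

lemma
  assumes "u \<in> solutions"
  shows convergent_lyapunov: "convergent (lyapunov u)"
    and increments_tendsto: "(\<lambda>n. norm (P (Suc n) - P n)) \<longlonglongrightarrow> 0"
proof -
  let ?c = "1 / 2 - 2 * \<theta>\<^sup>2"
  obtain v p where vp: "v \<in> normal_cone S u" "p \<in> normal_cone C u" "v + p + D u = 0" "u \<in> C"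
    using solutions_decompose[OF assms] .
  obtain e where e: "summable e" "\<And>n. 0 \<le> e n"
    "\<And>n q. lam n * (inner p (q - u) - \<beta> n * \<psi> q) \<le> e n"
    using penalty_summable[OF vp(2)] by blast
  have step: "\<forall>\<^sub>F n in sequentially. lyapunov u (Suc n) + ?c * (norm (P (Suc n) - P n))\<^sup>2
      \<le> lyapunov u n + 2 * e n"
    using step_size
  proof eventually_elim
    case (elim n)
    from lyapunov_step[OF elim vp(1) vp(4) e(3)] show ?case
      by (simp add: vp(3))
  qed
  have nonneg: "0 \<le> lyapunov u n" "0 \<le> ?c * (norm (P (Suc n) - P n))\<^sup>2" "0 \<le> 2 * e n" for n
    using penalty_coeff_pos e(2)[of n] by (auto simp: lyapunov_def)
  have "summable (\<lambda>n. 2 * e n)"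
    using e(1) by (rule summable_mult)
  from quasi_fejer[OF nonneg this step]
  show "convergent (lyapunov u)" and s: "(\<lambda>n. norm (P (Suc n) - P n)) \<longlonglongrightarrow> 0"
  proof -
    assume s: "summable (\<lambda>n. ?c * (norm (P (Suc n) - P n))\<^sup>2)"
    have "(\<lambda>n. (norm (P (Suc n) - P n))\<^sup>2) \<longlonglongrightarrow> 0"
      using summable_LIMSEQ_zero[OF s] penalty_coeff_pos
      by (subst (asm) tendsto_mult_left_iff[of ?c _ 0, simplified]) auto
    then show "(\<lambda>n. norm (P (Suc n) - P n)) \<longlonglongrightarrow> 0"
      by simp
  qed
qed

lemma correction_tendsto: "(\<lambda>n. w n - P n) \<longlonglongrightarrow> 0"
proof -
  obtain u where u: "u \<in> solutions"
    using solvable by (auto simp: solutions_def)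
  have "(\<lambda>n. w (Suc n) - P (Suc n)) \<longlonglongrightarrow> 0"
  proof (rule Lim_null_comparison)
    show "\<forall>\<^sub>F n in sequentially. norm (w (Suc n) - P (Suc n)) \<le> \<theta> * norm (P (Suc n) - P n)"
      using step_size by eventually_elim (rule correction_le)
    show "(\<lambda>n. \<theta> * norm (P (Suc n) - P n)) \<longlonglongrightarrow> 0"
      using tendsto_mult_left[OF increments_tendsto[OF u], of \<theta>] by simp
  qed
  then show ?thesis
    by (rule LIMSEQ_imp_Suc)
qed

text \<open>The descent estimate involves \<open>P (Suc n)\<close> while the averages are taken over
  \<open>w n\<close>; this lets one be exchanged for the other.\<close>

lemma gap_tendsto: "(\<lambda>n. w n - P (Suc n)) \<longlonglongrightarrow> 0"
proof -
  obtain u where u: "u \<in> solutions"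
    using solvable by (auto simp: solutions_def)
  have "(\<lambda>n. (w n - P n) - (P (Suc n) - P n)) \<longlonglongrightarrow> 0 - 0"
    using increments_tendsto[OF u]
    by (intro tendsto_diff correction_tendsto) (rule tendsto_norm_zero_cancel)
  then show ?thesis by simp
qed

lemma convergent_distance:
  assumes "u \<in> solutions"
  shows "convergent (\<lambda>n. (norm (w n - u))\<^sup>2)"
proof -
  have "(\<lambda>n. (norm (w n - P n))\<^sup>2) \<longlonglongrightarrow> 0\<^sup>2"
    by (intro tendsto_power tendsto_norm_zero correction_tendsto)
  then have "convergent (\<lambda>n. lyapunov u n - (norm (w n - P n))\<^sup>2)"
    by (intro convergent_diff convergent_lyapunov[OF assms]) (rule convergentI)
  then show ?thesis
    by (simp add: lyapunov_def)
qed

section \<open>Ergodic averages and their weak cluster points\<close>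

lemma lam_sum_pos: "0 < (\<Sum>k\<le>n. lam k)"
  using lam_pos by (intro sum_pos) auto

lemma inner_avg: "inner (avg n) g = (\<Sum>k\<le>n. lam k * inner (w k) g) / (\<Sum>k\<le>n. lam k)"
  by (simp add: avg_def inner_sum_left)

lemma avg_bounded: "\<exists>M. \<forall>n. norm (avg n) \<le> M"
proof -
  obtain u where u: "u \<in> solutions"
    using solvable by (auto simp: solutions_def)
  have "Bseq (\<lambda>n. (norm (w n - u))\<^sup>2)"
    using convergent_distance[OF u] by (rule convergent_imp_Bseq)
  then obtain K where K: "\<And>n. (norm (w n - u))\<^sup>2 \<le> K"
    unfolding Bseq_def by (auto dest: abs_le_D1)
  have w_bd: "norm (w n) \<le> sqrt K + norm u" for n
    using real_le_rsqrt[OF K[of n]] norm_triangle_ineq2[of "w n" u] by linarith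
  have "norm (avg n) \<le> sqrt K + norm u" for n
  proof -
    have "norm (\<Sum>k\<le>n. lam k *\<^sub>R w k) \<le> (\<Sum>k\<le>n. lam k * (sqrt K + norm u))"
      using lam_pos w_bd by (intro sum_norm_le) (simp add: less_imp_le)
    also have "\<dots> = (\<Sum>k\<le>n. lam k) * (sqrt K + norm u)"
      by (simp add: sum_distrib_right)
    finally show ?thesis
      using lam_sum_pos[of n] by (simp add: avg_def field_simps)
  qed
  then show ?thesis by blast
qed

text \<open>Telescoping \<open>lyapunov_step\<close> bounds the weighted sum of the linear terms
  below by a constant, which vanishes after division by the divergent total weight. The sequence b
  also collects the averaged gaps between \<open>P (Suc k)\<close> and \<open>w k\<close>.\<close>

lemma ergodic_inequality:
  assumes "v \<in> normal_cone S u" "p \<in> normal_cone C u"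
  shows "\<exists>b. b \<longlonglongrightarrow> 0 \<and> (\<forall>n. b n \<le> inner (v + p + D u) (u - avg n))"
proof -
  let ?g = "v + p + D u"
  let ?\<tau> = "\<lambda>n. \<Sum>k\<le>n. lam k"
  have u: "u \<in> C"
    using assms(2) by (auto simp: normal_cone_def split: if_splits)
  obtain e where e: "summable e" "\<And>n. 0 \<le> e n"
    "\<And>n q. lam n * (inner p (q - u) - \<beta> n * \<psi> q) \<le> e n"
    using penalty_summable[OF assms(2)] by blast
  obtain N where N: "\<And>n. n \<ge> N \<Longrightarrow> lam n * (\<beta> n * LB + LD) \<le> \<theta>"
    using step_size unfolding eventually_sequentially by blast
  define d where "d n = lam n * inner ?g (u - P (Suc n))" for n
  have descent: "lyapunov u (Suc n) \<le> lyapunov u n + 2 * d n + 2 * e n" if "n \<ge> N" for n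
    using lyapunov_step[OF N[OF that] assms(1) u e(3)] penalty_coeff_pos
    unfolding d_def by (smt (verit) mult_nonneg_nonneg zero_le_power2)
  have sum_bound: "lyapunov u n \<le> lyapunov u N + 2 * sum d {N..<n} + 2 * sum e {N..<n}" if "n \<ge> N" for n
    using that
  proof (induction n rule: dec_induct)
    case (step n)
    then show ?case using descent[of n] by simp
  qed simp
  have tail: "- (lyapunov u N / 2 + suminf e) \<le> sum d {N..<n}" if "n \<ge> N" for n
  proof -
    have "sum e {N..<n} \<le> suminf e"
      using sum_le_suminf[OF e(1), of "{N..<n}"] e(2) by simp
    moreover have "0 \<le> lyapunov u n"
      by (simp add: lyapunov_def)
    ultimately show ?thesis
      using sum_bound[OF that] by (simp add: field_simps)
  qed
  \<comment> \<open>The first two terms bound the telescoped part from \<open>N\<close> on; the last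
    covers the indices below \<open>N\<close>, where the step size bound may fail.\<close>
  define M where "M = lyapunov u N / 2 + suminf e + (\<Sum>k<N. \<bar>d k\<bar>)"
  have M: "- M \<le> (\<Sum>k\<le>n. d k)" for n
  proof (cases "Suc n \<ge> N")
    case True
    have "(\<Sum>k\<le>n. d k) = sum d {..<N} + sum d {N..<Suc n}"
      using sum.atLeastLessThan_concat[of 0 N "Suc n" d] True
      by (simp add: lessThan_Suc_atMost[symmetric] atLeast0LessThan)
    moreover have "- (\<Sum>k<N. \<bar>d k\<bar>) \<le> sum d {..<N}"
      unfolding sum_negf[symmetric] by (intro sum_mono) auto
    ultimately show ?thesis
      using tail[OF True] by (simp add: M_def)
  next
    case False
    have "- (\<Sum>k<N. \<bar>d k\<bar>) \<le> - (\<Sum>k\<le>n. \<bar>d k\<bar>)"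
      using False by (simp, intro sum_mono2) auto
    moreover have "- (\<Sum>k\<le>n. \<bar>d k\<bar>) \<le> (\<Sum>k\<le>n. d k)"
      unfolding sum_negf[symmetric] by (intro sum_mono) auto
    moreover have "0 \<le> lyapunov u N"
      by (simp add: lyapunov_def)
    moreover have "0 \<le> suminf e"
      using e by (intro suminf_nonneg)
    ultimately show ?thesis
      by (simp add: M_def)
  qed
  let ?a = "\<lambda>k. inner ?g (P (Suc k) - w k)"
  let ?b = "\<lambda>n. (\<Sum>k\<le>n. lam k * ?a k) / ?\<tau> n - M / ?\<tau> n"
  have "?a \<longlonglongrightarrow> inner ?g (- 0)"
    using tendsto_minus[OF gap_tendsto] by (intro tendsto_intros) simp
  then have "(\<lambda>n. (\<Sum>k\<le>n. lam k * ?a k) / ?\<tau> n) \<longlonglongrightarrow> 0"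
    using weighted_average_tendsto[OF lam_pos lam_div] by simp
  moreover have "(\<lambda>n. M / ?\<tau> n) \<longlonglongrightarrow> 0"
  proof -
    \<comment> \<open>The quotient of \<open>M\<close> by the total weight is the weighted average
      of the sequence with the single nonzero entry \<open>M / lam 0\<close>.\<close>
    have "(\<lambda>k. if k = 0 then M / lam 0 else 0) \<longlonglongrightarrow> 0"
      by (rule tendsto_eventually, rule eventually_sequentiallyI[of 1]) auto
    from weighted_average_tendsto[OF lam_pos lam_div this] show ?thesis
      using lam_pos[of 0] by (simp add: if_distrib[of "\<lambda>c. lam _ * c"] cong: if_cong)
  qed
  ultimately have "?b \<longlonglongrightarrow> 0 - 0"
    by (rule tendsto_diff)
  moreover have "?b n \<le> inner ?g (u - avg n)" for n
  proof -
    have "inner ?g (u - avg n) = (\<Sum>k\<le>n. lam k * inner ?g (u - w k)) / ?\<tau> n"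
      using lam_sum_pos[of n]
      by (simp add: inner_diff_right inner_commute[of ?g] inner_avg right_diff_distrib sum_subtractf
          sum_distrib_right[symmetric] diff_divide_distrib)
    also have "(\<Sum>k\<le>n. lam k * inner ?g (u - w k)) = (\<Sum>k\<le>n. lam k * ?a k) + (\<Sum>k\<le>n. d k)"
      by (simp add: d_def inner_diff_right right_diff_distrib sum.distrib[symmetric])
    finally show ?thesis
      using divide_right_mono[OF M[of n] less_imp_le[OF lam_sum_pos[of n]]]
      by (simp add: add_divide_distrib)
  qed
  ultimately show ?thesis
    by (intro exI[of _ ?b]) simp
qed

text \<open>The ergodic inequality is affine in the average, so it passes to weak limits. Large
  normal vectors then yield feasibility of \<open>l\<close>, and the zero normal vector yields
  optimality.\<close>

lemma weak_cluster_in_solutions: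
  assumes F: "F \<le> sequentially" "F \<noteq> bot" and l: "\<And>u. ((\<lambda>n. inner (avg n) u) \<longlongrightarrow> inner l u) F"
  shows "l \<in> solutions"
proof -
  have ineq: "0 \<le> inner (g + D u) (u - l)" if g: "g \<in> normal_cone (S \<inter> C) u" for u g
  proof -
    obtain v p where vp: "v \<in> normal_cone S u" "p \<in> normal_cone C u" "g = v + p"
      using normal_cone_feasible[OF g] by blast
    obtain b where b: "b \<longlonglongrightarrow> 0" "\<And>n. b n \<le> inner (g + D u) (u - avg n)"
      using ergodic_inequality[OF vp(1,2)] vp(3) by blast
    have "((\<lambda>n. inner (u - avg n) (g + D u)) \<longlongrightarrow> inner (u - l) (g + D u)) F"
      using tendsto_diff[OF tendsto_const l[of "g + D u"], of "inner u (g + D u)"]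
      by (simp only: inner_diff_left)
    then have "((\<lambda>n. inner (g + D u) (u - avg n)) \<longlongrightarrow> inner (g + D u) (u - l)) F"
      by (subst (1 2) inner_commute)
    moreover have "(b \<longlongrightarrow> 0) F"
      using b(1) F(1) by (rule tendsto_mono[rotated])
    ultimately show ?thesis
      using b(2) F(2) by (intro tendsto_le[of F]) auto
  qed
  obtain u0 where "u0 \<in> S \<inter> C"
    using solvable by (auto simp: normal_cone_def split: if_splits)
  then have ne: "S \<inter> C \<noteq> {}" by blast
  define u where "u = proj (S \<inter> C) l"
  note pr = proj_in[OF feasible_closed feasible_convex ne, of l]
    proj_obtuse[OF feasible_closed feasible_convex ne, of _ l]
  have cone: "l - u \<in> normal_cone (S \<inter> C) u"
    using pr by (auto simp: normal_cone_def u_def inner_commute)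
  \<comment> \<open>The vector \<open>l - u\<close> is normal at the projection \<open>u\<close>,
    and so are its multiples by 1/t, against which the fixed term \<open>D u\<close> becomes
    negligible.\<close>
  have "(norm (l - u))\<^sup>2 \<le> 0"
  proof (rule nonpos_if_le_small_multiples)
    fix t :: real
    assume t: "0 < t" "t \<le> 1"
    have "(1 / t) *\<^sub>R (l - u) \<in> normal_cone (S \<inter> C) u"
      using cone t by (intro normal_cone_scaleR) auto
    from ineq[OF this] have "0 \<le> (1 / t) * inner (l - u) (u - l) + inner (D u) (u - l)"
      by (simp add: inner_add_left)
    also have "inner (l - u) (u - l) = - (norm (l - u))\<^sup>2"
      unfolding power2_norm_eq_inner by (metis inner_minus_right minus_diff_eq)
    finally show "(norm (l - u))\<^sup>2 \<le> t * inner (D u) (u - l)"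
      using t by (simp add: field_simps)
  qed
  then have "u = l" by simp
  then have lE: "l \<in> S \<inter> C"
    using pr(1) by (simp add: u_def)
  have zero_cone: "0 \<in> normal_cone (S \<inter> C) u" if "u \<in> S \<inter> C" for u
    using that by (simp add: normal_cone_def)
  \<comment> \<open>Minty's argument: the inequality is tested at points between \<open>l\<close>
    and \<open>q\<close>, and Lipschitz continuity of \<open>D\<close> lets them tend to
    \<open>l\<close>.\<close>
  have "inner (q - l) (- D l) \<le> 0" if q: "q \<in> S \<inter> C" for q
  proof (rule nonpos_if_le_small_multiples)
    fix t :: real
    assume t: "0 < t" "t \<le> 1"
    let ?y = "l + t *\<^sub>R (q - l)"
    have "(1 - t) *\<^sub>R l + t *\<^sub>R q \<in> S \<inter> C"
      using feasible_convex lE q t by (intro convexD) auto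
    then have "?y \<in> S \<inter> C"
      by (simp add: algebra_simps)
    from ineq[OF zero_cone[OF this]] have "0 \<le> inner (D ?y) (q - l)"
      using t by (simp add: zero_le_mult_iff)
    then have "inner (q - l) (- D l) \<le> inner (D ?y - D l) (q - l)"
      by (simp add: inner_diff_left[of "D ?y"] inner_commute[of "q - l"])
    also have "\<dots> \<le> norm (D ?y - D l) * norm (q - l)"
      by (rule norm_cauchy_schwarz)
    also have "\<dots> \<le> (LD * (t * norm (q - l))) * norm (q - l)"
      using lipschitz_onD[OF D_lipschitz, of ?y l] t by (intro mult_right_mono) (auto simp: dist_norm)
    finally show "inner (q - l) (- D l) \<le> t * (LD * norm (q - l) * norm (q - l))"
      by (simp add: mult_ac)
  qed
  with lE show ?thesis
    by (simp add: solutions_def normal_cone_def)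
qed

lemma avg_weakly_converges: "\<exists>l\<in>solutions. weakly_converges avg l"
proof -
  obtain M where M: "\<And>n. norm (avg n) \<le> M"
    using avg_bounded by blast
  obtain F l where F: "F \<le> sequentially" "F \<noteq> bot"
    and l: "\<And>u. ((\<lambda>n. inner (avg n) u) \<longlongrightarrow> inner l u) F"
    by (rule weak_cluster_point[where z = avg, OF M sequentially_bot]) (rule that)
  have ls: "l \<in> solutions"
    using weak_cluster_in_solutions[OF F l] .
  have "(\<lambda>n. inner (avg n) g) \<longlonglongrightarrow> inner l g" for g
  proof (rule ccontr)
    assume "\<not> ?thesis"
    then obtain e where e: "e > 0" "\<not> (\<forall>\<^sub>F n in sequentially. dist (inner (avg n) g) (inner l g) < e)"
      unfolding tendsto_iff by blast
    \<comment> \<open>\<open>G\<close> confines attention to indices where the functional stays at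
      least \<open>e\<close> away from its supposed limit; it is proper because these indices recur
      forever.\<close>
    define G where "G = inf sequentially (principal {n. dist (inner (avg n) g) (inner l g) \<ge> e})"
    have "G \<noteq> bot"
      using e(2) by (simp add: G_def trivial_limit_def eventually_inf_principal not_le)
    obtain F' l' where F': "F' \<le> G" "F' \<noteq> bot"
      and l': "\<And>u. ((\<lambda>n. inner (avg n) u) \<longlongrightarrow> inner l' u) F'"
      by (rule weak_cluster_point[where z = avg, OF M \<open>G \<noteq> bot\<close>]) (rule that)
    have F's: "F' \<le> sequentially"
      using F'(1) by (simp add: G_def)
    have l's: "l' \<in> solutions"
      using weak_cluster_in_solutions[OF F's F'(2) l'] .
    have "convergent (\<lambda>n. (norm (w n - l'))\<^sup>2 - (norm (w n - l))\<^sup>2)"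
      by (intro convergent_diff convergent_distance ls l's)
    then obtain c where c: "(\<lambda>n. (norm (w n - l'))\<^sup>2 - (norm (w n - l))\<^sup>2) \<longlonglongrightarrow> c"
      unfolding convergent_def by blast
    \<comment> \<open>The quadratic terms in \<open>w n\<close> cancel, so convergence of both
      distances makes this inner product, and then its weighted averages, converge. Both cluster
      points must give the same limit.\<close>
    have "inner (w n) (l - l') = ((norm (w n - l'))\<^sup>2 - (norm (w n - l))\<^sup>2
        + (norm l)\<^sup>2 - (norm l')\<^sup>2) / 2" for n
      unfolding power2_norm_eq_inner
      by (simp add: inner_diff_left inner_diff_right inner_commute)
    then have "(\<lambda>n. inner (w n) (l - l')) \<longlonglongrightarrow> (c + (norm l)\<^sup>2 - (norm l')\<^sup>2) / 2"
      by (simp only:) (intro tendsto_intros c, simp)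
    from weighted_average_tendsto[OF lam_pos lam_div this]
    obtain k where k: "(\<lambda>n. inner (avg n) (l - l')) \<longlonglongrightarrow> k"
      by (auto simp: inner_avg)
    have "inner l (l - l') = k" "inner l' (l - l') = k"
      using tendsto_unique[OF F(2) l tendsto_mono[OF F(1) k]]
        tendsto_unique[OF F'(2) l' tendsto_mono[OF F's k]] .
    then have "inner (l - l') (l - l') = 0"
      by (simp add: inner_diff_left)
    then have "l' = l" by simp
    then have "\<forall>\<^sub>F n in F'. dist (inner (avg n) g) (inner l g) < e"
      using l'[of g] e(1) by (simp add: tendsto_iff)
    moreover have "\<forall>\<^sub>F n in F'. dist (inner (avg n) g) (inner l g) \<ge> e"
      using F'(1) unfolding G_def
      by (rule filter_leD) (simp add: eventually_inf_principal)
    ultimately have "\<forall>\<^sub>F n in F'. False"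
      by eventually_elim simp
    with F'(2) show False
      by (simp add: trivial_limit_def)
  qed
  with ls show ?thesis
    by (auto simp: weakly_converges_def)
qed

end

section \<open>Gradients, normal cones and conjugates\<close>

lemma GDERIV_unique:
  assumes "GDERIV f x :> g" "GDERIV f x :> g'"
  shows "g = g'"
proof -
  have "(\<lambda>h. inner h g) = (\<lambda>h. inner h g')"
    using assms has_derivative_unique unfolding gderiv_def by blast
  then show ?thesis
    by (metis vector_eq_ldot)
qed

lemma grad_eqI: "GDERIV f x :> g \<Longrightarrow> grad f x = g"
  unfolding grad_def by (rule the_equality) (auto intro: GDERIV_unique)

text \<open>Riesz represents the derivative by a vector, so the definite description in
  \<open>grad\<close> denotes it.\<close>

lemma GDERIV_grad:
  fixes f :: "'a::{real_inner,complete_space} \<Rightarrow> real"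
  assumes "f differentiable (at x)"
  shows "GDERIV f x :> grad f x"
proof -
  obtain f' where f': "(f has_derivative f') (at x)"
    using assms by (auto simp: differentiable_def)
  then obtain g where g: "\<And>h. f' h = inner h g"
    using riesz_representation has_derivative_bounded_linear by blast
  then have "f' = (\<lambda>h. inner h g)" by blast
  then have "GDERIV f x :> g"
    using f' by (simp add: gderiv_def)
  then show ?thesis
    by (simp add: grad_eqI)
qed

lemma GDERIV_half_norm_sq_affine:
  fixes K :: "'a::{real_inner,complete_space} \<Rightarrow> 'b::real_inner"
  assumes "bounded_linear K"
  shows "GDERIV (\<lambda>u. 1 / 2 * (norm (K u - b))\<^sup>2) u :> adjoint K (K u - b)"
proof -
  have "((\<lambda>u. K u - b) has_derivative K) (at u)"
    using has_derivative_diff[OF bounded_linear_imp_has_derivative[OF assms] has_derivative_const]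
    by simp
  from has_derivative_mult_right[OF has_derivative_inner[OF this this], of "1 / 2"]
  show ?thesis
    unfolding gderiv_def inner_adjoint[OF assms] power2_norm_eq_inner
    by (simp add: inner_commute)
qed

text \<open>Restriction to the line through x and y reduces the claim to the tangent inequality in
  one variable.\<close>

lemma convex_on_gradient_inequality:
  fixes f :: "'a::real_inner \<Rightarrow> real"
  assumes convex: "convex_on UNIV f" and deriv: "GDERIV f x :> g"
  shows "f x + inner (y - x) g \<le> f y"
proof -
  define \<phi> where "\<phi> t = f (x + t *\<^sub>R (y - x))" for t
  have "convex_on UNIV \<phi>"
  proof (rule convex_onI)
    fix t a c :: real
    assume t: "0 < t" "t < 1"
    have "x + ((1 - t) *\<^sub>R a + t *\<^sub>R c) *\<^sub>R (y - x)
        = (1 - t) *\<^sub>R (x + a *\<^sub>R (y - x)) + t *\<^sub>R (x + c *\<^sub>R (y - x))"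
      by (simp add: algebra_simps)
    then show "\<phi> ((1 - t) *\<^sub>R a + t *\<^sub>R c) \<le> (1 - t) * \<phi> a + t * \<phi> c"
      unfolding \<phi>_def using convex_onD[OF convex, of t "x + a *\<^sub>R (y - x)" "x + c *\<^sub>R (y - x)"] t by simp
  qed simp
  moreover have "(\<phi> has_real_derivative inner (y - x) g) (at 0)"
  proof -
    have "((\<lambda>t. x + t *\<^sub>R (y - x)) has_derivative (\<lambda>t. t *\<^sub>R (y - x))) (at 0)"
      by (auto intro!: derivative_eq_intros)
    moreover have "(f has_derivative (\<lambda>h. inner h g)) (at (x + 0 *\<^sub>R (y - x)))"
      using deriv by (simp add: gderiv_def)
    ultimately have "(\<phi> has_derivative (\<lambda>t. inner (t *\<^sub>R (y - x)) g)) (at 0)"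
      unfolding \<phi>_def by (rule has_derivative_compose)
    then show ?thesis
      by (simp add: has_field_derivative_def mult.commute[of _ "inner (y - x) g"])
  qed
  ultimately have "inner (y - x) g * (1 - 0) \<le> \<phi> 1 - \<phi> 0"
    using convex_on_imp_above_tangent[of UNIV \<phi> 0 1 "inner (y - x) g"] by simp
  then show ?thesis
    by (simp add: \<phi>_def)
qed

lemma normal_cone_Times:
  "normal_cone (S \<times> T) (u, v) = normal_cone S u \<times> normal_cone T v"
proof (cases "u \<in> S \<and> v \<in> T")
  case True
  have "p \<in> normal_cone S u \<and> q \<in> normal_cone T v" if "(p, q) \<in> normal_cone (S \<times> T) (u, v)" for p q
    using that True by (fastforce simp: normal_cone_def)
  moreover have "(p, q) \<in> normal_cone (S \<times> T) (u, v)"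
    if "p \<in> normal_cone S u" "q \<in> normal_cone T v" for p q
    using that True by (auto simp: normal_cone_def add_nonpos_nonpos)
  ultimately show ?thesis by auto
next
  case False
  then show ?thesis by (auto simp: normal_cone_def)
qed

text \<open>The normal cone of an intersection always contains the sum of the normal cones, so maximality
  of the sum forces equality: no constraint qualification is needed.\<close>

lemma normal_cone_Int_eq_sum:
  assumes "maximally_monotone (\<lambda>w. normal_cone S w + normal_cone C w)"
  shows "normal_cone (S \<inter> C) w = normal_cone S w + normal_cone C w"
proof -
  have "monotone_operator (normal_cone (S \<inter> C))"
    unfolding monotone_operator_def
  proof (intro allI impI)
    fix x y u v
    assume "u \<in> normal_cone (S \<inter> C) x" "v \<in> normal_cone (S \<inter> C) y"
    then have "inner (y - x) u \<le> 0" "inner (x - y) v \<le> 0"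
      by (auto simp: normal_cone_def split: if_splits)
    then show "0 \<le> inner (x - y) (u - v)"
      by (simp add: inner_diff_left inner_diff_right)
  qed
  moreover have "normal_cone S w + normal_cone C w \<subseteq> normal_cone (S \<inter> C) w" for w
    by (auto simp: set_plus_def normal_cone_def inner_add_right add_nonpos_nonpos)
  ultimately have "normal_cone (S \<inter> C) = (\<lambda>w. normal_cone S w + normal_cone C w)"
    using assms unfolding maximally_monotone_def by blast
  then show ?thesis by (rule fun_cong)
qed

text \<open>As \<open>p\<close> is normal at \<open>u\<close>, the support function is attained at
  \<open>u\<close>. The Fenchel-Young inequality then makes the terms of the conjugate series
  dominate the penalty defect at every \<open>q\<close>.\<close>

lemma penalty_bound_summable:
  fixes \<psi> :: "'a::real_inner \<Rightarrow> real" and lam \<beta> :: "nat \<Rightarrow> real"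
  assumes pos: "\<And>n. lam n > 0" "\<And>n. \<beta> n > 0"
    and fin: "(\<Sum>n. ereal (lam n * \<beta> n) * (fenchel_conjugate \<psi> (p /\<^sub>R \<beta> n)
                - support_function {u. \<psi> u = 0} (p /\<^sub>R \<beta> n))) < \<infinity>"
    and p: "p \<in> normal_cone {u. \<psi> u = 0} u"
  shows "\<exists>e. summable e \<and> (\<forall>n. 0 \<le> e n) \<and> (\<forall>n q. lam n * (inner p (q - u) - \<beta> n * \<psi> q) \<le> e n)"
proof -
  define T where "T n = ereal (lam n * \<beta> n) * (fenchel_conjugate \<psi> (p /\<^sub>R \<beta> n)
    - support_function {u. \<psi> u = 0} (p /\<^sub>R \<beta> n))" for n
  have u: "\<psi> u = 0" and le: "\<And>y. \<psi> y = 0 \<Longrightarrow> inner (y - u) p \<le> 0"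
    using p by (auto simp: normal_cone_def split: if_splits)
  have supp: "support_function {u. \<psi> u = 0} (p /\<^sub>R \<beta> n) = ereal (inner u (p /\<^sub>R \<beta> n))" for n
    unfolding support_function_def
  proof (rule antisym)
    show "(SUP y\<in>{u. \<psi> u = 0}. ereal (inner y (p /\<^sub>R \<beta> n))) \<le> ereal (inner u (p /\<^sub>R \<beta> n))"
    proof (rule SUP_least)
      fix y assume "y \<in> {u. \<psi> u = 0}"
      then have "inner y p \<le> inner u p"
        using le[of y] by (simp add: inner_diff_left)
      then show "ereal (inner y (p /\<^sub>R \<beta> n)) \<le> ereal (inner u (p /\<^sub>R \<beta> n))"
        using pos(2)[of n] by (simp add: mult_left_mono)
    qed
    show "ereal (inner u (p /\<^sub>R \<beta> n)) \<le> (SUP y\<in>{u. \<psi> u = 0}. ereal (inner y (p /\<^sub>R \<beta> n)))"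
      using u by (intro SUP_upper) simp
  qed
  have T_ge: "ereal (lam n * (inner p (q - u) - \<beta> n * \<psi> q)) \<le> T n" for n q
  proof -
    have "ereal (inner (p /\<^sub>R \<beta> n) q - \<psi> q) \<le> fenchel_conjugate \<psi> (p /\<^sub>R \<beta> n)"
      unfolding fenchel_conjugate_def by (rule SUP_upper) simp
    then have "ereal (inner (p /\<^sub>R \<beta> n) q - \<psi> q) - ereal (inner u (p /\<^sub>R \<beta> n))
        \<le> fenchel_conjugate \<psi> (p /\<^sub>R \<beta> n) - support_function {u. \<psi> u = 0} (p /\<^sub>R \<beta> n)"
      unfolding supp by (intro ereal_minus_mono) auto
    then have "ereal (lam n * \<beta> n) * (ereal (inner (p /\<^sub>R \<beta> n) q - \<psi> q) - ereal (inner u (p /\<^sub>R \<beta> n)))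
        \<le> T n"
      unfolding T_def using pos by (intro ereal_mult_left_mono) (simp_all add: mult_nonneg_nonneg less_imp_le)
    also have "ereal (lam n * \<beta> n) * (ereal (inner (p /\<^sub>R \<beta> n) q - \<psi> q) - ereal (inner u (p /\<^sub>R \<beta> n)))
        = ereal (lam n * \<beta> n * (inner (p /\<^sub>R \<beta> n) q - \<psi> q - inner u (p /\<^sub>R \<beta> n)))"
      by simp
    also have "lam n * \<beta> n * (inner (p /\<^sub>R \<beta> n) q - \<psi> q - inner u (p /\<^sub>R \<beta> n))
        = lam n * (inner p (q - u) - \<beta> n * \<psi> q)"
      using pos(2)[of n] by (simp add: inner_diff_right inner_commute[of u] field_simps)
    finally show ?thesis .
  qed
  \<comment> \<open>Take \<open>q = u\<close>, where \<open>\<psi>\<close> vanishes.\<close>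
  have T_nonneg: "0 \<le> T n" for n
    using T_ge[of n u] u by (simp add: zero_ereal_def)
  \<comment> \<open>A finite sum of nonnegative extended reals has only finite terms, so the series
    can be read over the reals.\<close>
  have "suminf T \<noteq> \<infinity>"
    using fin unfolding T_def by (rule less_imp_neq)
  then obtain e where e: "T = (\<lambda>n. ereal (e n))"
    using suminf_PInfty_fun[where f = T, OF T_nonneg] by blast
  have "0 \<le> e n" for n
    using T_nonneg[of n] by (simp add: e)
  moreover from this have "summable e"
    using \<open>suminf T \<noteq> \<infinity>\<close> by (intro summable_ereal) (auto simp: e)
  moreover have "lam n * (inner p (q - u) - \<beta> n * \<psi> q) \<le> e n" for n q
    using T_ge[of n q] by (simp add: e)
  ultimately show ?thesis by blast
qed

text \<open>Feasibility writes the residual as the image of \<open>u - u0\<close>, so pairing the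
  gradient with \<open>u - u0\<close> yields its squared norm.\<close>

lemma grad_half_norm_sq_eq_0_iff:
  fixes K :: "'a::{real_inner,complete_space} \<Rightarrow> 'b::real_inner"
  assumes "bounded_linear K" "K u0 = b"
  shows "adjoint K (K u - b) = 0 \<longleftrightarrow> K u = b"
proof
  interpret K: bounded_linear K by fact
  assume "adjoint K (K u - b) = 0"
  then have "inner (u - u0) (adjoint K (K u - b)) = 0" by simp
  then show "K u = b"
    by (simp add: inner_adjoint[OF assms(1)] K.diff assms(2))
next
  interpret K: bounded_linear K by fact
  have "inner v (adjoint K 0) = 0" for v
    by (simp add: inner_adjoint[OF assms(1)])
  then have "adjoint K 0 = 0"
    by (metis inner_eq_zero_iff)
  then show "K u = b \<Longrightarrow> adjoint K (K u - b) = 0" by simp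
qed

lemma closed_convex_affine_constraint:
  assumes "bounded_linear K"
  shows "closed {u. K u = b}" "convex {u. K u = b}"
proof -
  interpret K: bounded_linear K by fact
  show "closed {u. K u = b}"
    by (intro closed_Collect_eq K.continuous_on continuous_intros)
  show "convex {u. K u = b}"
    by (auto simp: convex_def K.add K.scaleR scaleR_add_left[symmetric])
qed

section \<open>Weak ergodic convergence to saddle points\<close>

theorem corollary7:
  fixes f :: "'h::{real_inner,complete_space} \<times> 'g::{real_inner,complete_space} \<Rightarrow> real"
    and X :: "'h set" and Y :: "'g set"
    and K1 :: "'h \<Rightarrow> 'q::{real_inner,complete_space}"
    and K2 :: "'g \<Rightarrow> 'p::{real_inner,complete_space}"
    and b :: 'q and b' :: 'p
    and \<psi>1 :: "'h \<Rightarrow> real" and \<psi>2 :: "'g \<Rightarrow> real"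
    and A :: "'h \<times> 'g \<Rightarrow> ('h \<times> 'g) set"
    and B D :: "'h \<times> 'g \<Rightarrow> 'h \<times> 'g"
    and C :: "('h \<times> 'g) set"
    and \<eta> \<mu> :: real
    and lam \<beta> \<tau> :: "nat \<Rightarrow> real"
    and x :: "nat \<Rightarrow> 'h" and y :: "nat \<Rightarrow> 'g"
    and r :: "int \<Rightarrow> 'h" and s :: "int \<Rightarrow> 'g"
    and z :: "nat \<Rightarrow> 'h \<times> 'g"
  assumes "f differentiable_on UNIV"
    and "\<And>v. convex_on UNIV (\<lambda>u. f (u, v))"
    and "\<And>u. concave_on UNIV (\<lambda>v. f (u, v))"
    and "X \<noteq> {}" "closed X" "convex X"
    and "Y \<noteq> {}" "closed Y" "convex Y"
    and "bounded_linear K1" "K1 \<noteq> (\<lambda>_. 0)" "closed (range K1)"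
    and "bounded_linear K2" "K2 \<noteq> (\<lambda>_. 0)" "closed (range K2)"
    and "{u \<in> X. K1 u = b} \<noteq> {}" "{v \<in> Y. K2 v = b'} \<noteq> {}"
    and "\<psi>1 = (\<lambda>u. 1 / 2 * (norm (K1 u - b))\<^sup>2)"
    and "\<psi>2 = (\<lambda>v. 1 / 2 * (norm (K2 v - b'))\<^sup>2)"
    and "A = (\<lambda>(u, v). normal_cone X u \<times> normal_cone Y v)"
    and "B = (\<lambda>(u, v). (grad \<psi>1 u, grad \<psi>2 v))"
    and "C = zer_op (\<lambda>w. {B w})"
    and "D = (\<lambda>(u, v). (grad1 f u v, - grad2 f u v))"
    and "maximally_monotone A"
    and "monotone_operator (\<lambda>w. {D w})" "\<eta> > 0" "(inverse \<eta>)-lipschitz_on UNIV D"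
    and "monotone_operator (\<lambda>w. {B w})" "inverse \<mu> = max ((onorm K1)\<^sup>2) ((onorm K2)\<^sup>2)"
        "(inverse \<mu>)-lipschitz_on UNIV B"
    and "C \<noteq> {}"
    and "\<And>n. lam n > 0" "\<And>n. \<beta> n > 0"
    and "x 0 = r (- 1)" "y 0 = s (- 1)"
    and "\<And>n. r (int n) = proj X (x n - lam n *\<^sub>R grad1 f (r (int n - 1)) (s (int n - 1))
             - (lam n * \<beta> n) *\<^sub>R adjoint K1 (K1 (r (int n - 1)) - b))"
    and "\<And>n. s (int n) = proj Y (y n + lam n *\<^sub>R grad2 f (r (int n - 1)) (s (int n - 1))
             - (lam n * \<beta> n) *\<^sub>R adjoint K2 (K2 (s (int n - 1)) - b'))"
    and "\<And>n. x (Suc n) =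
           (lam n * \<beta> n) *\<^sub>R (adjoint K1 (K1 (r (int n - 1)) - b) - adjoint K1 (K1 (r (int n)) - b))
             + lam n *\<^sub>R grad1 f (r (int n - 1)) (s (int n - 1))
             - lam n *\<^sub>R grad1 f (r (int n)) (s (int n)) + r (int n)"
    and "\<And>n. y (Suc n) =
           (lam n * \<beta> n) *\<^sub>R (adjoint K2 (K2 (s (int n - 1)) - b') - adjoint K2 (K2 (s (int n)) - b'))
             + lam n *\<^sub>R grad2 f (r (int n)) (s (int n))
             - lam n *\<^sub>R grad2 f (r (int n - 1)) (s (int n - 1)) + s (int n)"
    and "\<And>n. \<tau> n = (\<Sum>k\<le>n. lam k)"
    and "\<And>n. z n = (1 / \<tau> n) *\<^sub>R (\<Sum>k\<le>n. lam k *\<^sub>R (x k, y k))"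
    and "maximally_monotone (\<lambda>w. A w + normal_cone C w)"
    and "\<exists>xb yb. (0, 0) \<in> A (xb, yb) + normal_cone C (xb, yb) + {D (xb, yb)}"
    and "\<And>p. p \<in> ran_op (normal_cone {u. \<psi>1 u = 0}) \<Longrightarrow>
           (\<Sum>n. ereal (lam n * \<beta> n) * (fenchel_conjugate \<psi>1 (p /\<^sub>R \<beta> n)
                - support_function {u. \<psi>1 u = 0} (p /\<^sub>R \<beta> n))) < \<infinity>"
    and "\<And>p. p \<in> ran_op (normal_cone {v. \<psi>2 v = 0}) \<Longrightarrow>
           (\<Sum>n. ereal (lam n * \<beta> n) * (fenchel_conjugate \<psi>2 (p /\<^sub>R \<beta> n)
                - support_function {v. \<psi>2 v = 0} (p /\<^sub>R \<beta> n))) < \<infinity>"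
    and "summable (\<lambda>n. (lam n)\<^sup>2)" "\<not> summable lam"
    and "limsup (\<lambda>n. ereal (lam n * \<beta> n / \<mu> + lam n / \<eta>)) < ereal (1 / 2)"
  shows "\<exists>xb yb. saddle_point f {u \<in> X. K1 u = b} {v \<in> Y. K2 v = b'} xb yb \<and>
           weakly_converges z (xb, yb)"
proof -
  note f_diff = assms(1) and f_convex = assms(2) and f_concave = assms(3)
    and X = assms(4-6) and Y = assms(7-9) and K1 = assms(10) and K2 = assms(13)
    and feasible = assms(16,17) and \<psi>1 = assms(18) and \<psi>2 = assms(19) and A = assms(20)
    and B = assms(21) and C = assms(22) and D = assms(23)
    and D_mono = assms(25) and \<eta> = assms(26) and D_lip = assms(27) and B_lip = assms(30)
    and lam_pos = assms(32) and \<beta>_pos = assms(33) and r = assms(36) and s = assms(37)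
    and x_Suc = assms(38) and y_Suc = assms(39) and \<tau> = assms(40) and z = assms(41)
    and maximal = assms(42) and solvable = assms(43) and conj1 = assms(44) and conj2 = assms(45)
    and lam_div = assms(47) and limsup = assms(48)
  let ?C1 = "{u. K1 u = b}" and ?C2 = "{v. K2 v = b'}"
  have B_eq: "B = (\<lambda>(u, v). (adjoint K1 (K1 u - b), adjoint K2 (K2 v - b')))"
    unfolding B \<psi>1 \<psi>2
    by (simp only: grad_eqI[OF GDERIV_half_norm_sq_affine[OF K1]]
        grad_eqI[OF GDERIV_half_norm_sq_affine[OF K2]])
  obtain u0 v0 where uv0: "u0 \<in> X" "K1 u0 = b" "v0 \<in> Y" "K2 v0 = b'"
    using feasible by blast
  have "(u, v) \<in> C \<longleftrightarrow> (u, v) \<in> ?C1 \<times> ?C2" for u v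
  proof -
    have "(u, v) \<in> C \<longleftrightarrow> adjoint K1 (K1 u - b) = 0 \<and> adjoint K2 (K2 v - b') = 0"
      by (auto simp: C zer_op_def B_eq zero_prod_def)
    then show ?thesis
      by (simp only: grad_half_norm_sq_eq_0_iff[OF K1 uv0(2)] grad_half_norm_sq_eq_0_iff[OF K2 uv0(4)]
          mem_Sigma_iff mem_Collect_eq)
  qed
  then have C_eq: "C = ?C1 \<times> ?C2"
    by auto
  have zer1: "{u. \<psi>1 u = 0} = ?C1" and zer2: "{v. \<psi>2 v = 0} = ?C2"
    by (auto simp: \<psi>1 \<psi>2)
  have A_eq: "A = normal_cone (X \<times> Y)"
    by (auto simp: A normal_cone_Times fun_eq_iff)
  have SC: "(X \<times> Y) \<inter> C = (X \<inter> ?C1) \<times> (Y \<inter> ?C2)"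
    by (auto simp: C_eq)
  have cone_sum: "normal_cone ((X \<times> Y) \<inter> C) w = normal_cone (X \<times> Y) w + normal_cone C w" for w
    using normal_cone_Int_eq_sum maximal unfolding A_eq by blast
  define \<psi> where "\<psi> w = \<psi>1 (fst w) + \<psi>2 (snd w)" for w
  define P where "P n = (r (int n - 1), s (int n - 1))" for n
  define w where "w n = (x n, y n)" for n
  \<comment> \<open>The strict limsup bound leaves room for a constant below 1/2 that bounds the
    step sizes eventually; the maximum with 0 below makes nonnegativity immediate.\<close>
  obtain \<theta>0 where \<theta>0: "limsup (\<lambda>n. ereal (lam n * \<beta> n / \<mu> + lam n / \<eta>)) < ereal \<theta>0" "\<theta>0 < 1 / 2"
    using ereal_dense2[OF limsup] by auto
  define \<theta> where "\<theta> = max \<theta>0 0"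

  interpret penalty_iteration "X \<times> Y" C B D \<psi> "inverse \<mu>" "inverse \<eta>" \<theta> lam \<beta> P w
  proof
    show "closed ((X \<times> Y) \<inter> C)" "convex ((X \<times> Y) \<inter> C)"
      unfolding SC using X Y closed_convex_affine_constraint[OF K1] closed_convex_affine_constraint[OF K2]
      by (auto intro!: closed_Times convex_Times closed_Int convex_Int)
    show "0 \<le> inner (u - v) (D u - D v)" for u v
      using D_mono unfolding monotone_operator_def by blast
    show "(inverse \<eta>)-lipschitz_on UNIV D" "(inverse \<mu>)-lipschitz_on UNIV B"
      by fact+
    show "\<psi> q \<le> inner (B q) (q - u)" if "u \<in> C" for u q
    proof -
      interpret K1: bounded_linear K1 by fact
      interpret K2: bounded_linear K2 by fact
      obtain q1 q2 u1 u2 where qu: "q = (q1, q2)" "u = (u1, u2)"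
        by (metis surj_pair)
      have "K1 u1 = b" "K2 u2 = b'"
        using that by (auto simp: C_eq qu)
      \<comment> \<open>Since \<open>u\<close> satisfies the constraints, the adjoints turn the
        pairing into squared residuals, which is twice \<open>\<psi> q\<close>.\<close>
      then have "inner (B q) (q - u) = (norm (K1 q1 - b))\<^sup>2 + (norm (K2 q2 - b'))\<^sup>2"
        by (simp add: B_eq qu inner_commute[of "adjoint _ _"] inner_adjoint K1 K2 K1.diff K2.diff
            power2_norm_eq_inner)
      then show ?thesis
        by (simp add: \<psi>_def \<psi>1 \<psi>2 qu add_mono)
    qed
    show "lam n > 0" "\<beta> n > 0" for n
      by fact+
    show "\<not> summable lam" by fact
    show "P (Suc n) \<in> X \<times> Y" for n
      by (simp add: P_def r s proj_in X Y)
    show "inner (w n - lam n *\<^sub>R (D (P n) + \<beta> n *\<^sub>R B (P n)) - P (Suc n)) (q - P (Suc n)) \<le> 0"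
      if qXY: "q \<in> X \<times> Y" for n q
    proof -
      obtain q1 q2 where q: "q = (q1, q2)" "q1 \<in> X" "q2 \<in> Y"
        using qXY by blast
      let ?a = "x n - lam n *\<^sub>R grad1 f (r (int n - 1)) (s (int n - 1))
             - (lam n * \<beta> n) *\<^sub>R adjoint K1 (K1 (r (int n - 1)) - b)"
      let ?c = "y n + lam n *\<^sub>R grad2 f (r (int n - 1)) (s (int n - 1))
             - (lam n * \<beta> n) *\<^sub>R adjoint K2 (K2 (s (int n - 1)) - b')"
      have "w n - lam n *\<^sub>R (D (P n) + \<beta> n *\<^sub>R B (P n)) = (?a, ?c)"
        by (simp add: w_def P_def D B_eq algebra_simps)
      moreover have "inner (?a - r (int n)) (q1 - r (int n)) \<le> 0"
        using proj_obtuse[OF X(2,3,1) q(2), of ?a] by (simp only: r)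
      moreover have "inner (?c - s (int n)) (q2 - s (int n)) \<le> 0"
        using proj_obtuse[OF Y(2,3,1) q(3), of ?c] by (simp only: s)
      ultimately show ?thesis
        by (simp add: P_def q(1))
    qed
    show "w (Suc n) = P (Suc n) + lam n *\<^sub>R (D (P n) + \<beta> n *\<^sub>R B (P n))
      - lam n *\<^sub>R (D (P (Suc n)) + \<beta> n *\<^sub>R B (P (Suc n)))" for n
      by (simp add: w_def P_def D B_eq x_Suc y_Suc algebra_simps)
    show "\<forall>\<^sub>F n in sequentially. lam n * (\<beta> n * inverse \<mu> + inverse \<eta>) \<le> \<theta>"
      using Limsup_lessD[OF \<theta>0(1)]
      by eventually_elim (simp add: \<theta>_def divide_inverse algebra_simps)
    show "0 \<le> \<theta>" "\<theta> < 1 / 2"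
      using \<theta>0(2) by (auto simp: \<theta>_def)
    show "\<exists>e. summable e \<and> (\<forall>n. 0 \<le> e n) \<and> (\<forall>n q. lam n * (inner p (q - u) - \<beta> n * \<psi> q) \<le> e n)"
      if "p \<in> normal_cone C u" for p u
    proof -
      obtain p1 p2 u1 u2 where pu: "p = (p1, p2)" "u = (u1, u2)"
        by (metis surj_pair)
      have p1: "p1 \<in> normal_cone {u. \<psi>1 u = 0} u1" and p2: "p2 \<in> normal_cone {v. \<psi>2 v = 0} u2"
        using that by (simp_all add: C_eq pu normal_cone_Times zer1 zer2)
      then have "p1 \<in> ran_op (normal_cone {u. \<psi>1 u = 0})" "p2 \<in> ran_op (normal_cone {v. \<psi>2 v = 0})"
        by (auto simp: ran_op_def)
      then obtain e1 e2 where
        e1: "summable e1" "\<And>n. 0 \<le> e1 n"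
          "\<And>n q. lam n * (inner p1 (q - u1) - \<beta> n * \<psi>1 q) \<le> e1 n" and
        e2: "summable e2" "\<And>n. 0 \<le> e2 n"
          "\<And>n q. lam n * (inner p2 (q - u2) - \<beta> n * \<psi>2 q) \<le> e2 n"
        using penalty_bound_summable[OF lam_pos \<beta>_pos conj1 p1]
          penalty_bound_summable[OF lam_pos \<beta>_pos conj2 p2] by blast
      have "lam n * (inner p (q - u) - \<beta> n * \<psi> q) \<le> e1 n + e2 n" for n q
        using add_mono[OF e1(3)[of n "fst q"] e2(3)[of n "snd q"]]
        by (cases q) (simp add: pu \<psi>_def algebra_simps)
      then show ?thesis
        using e1(1,2) e2(1,2) by (intro exI[of _ "\<lambda>n. e1 n + e2 n"]) (auto intro: summable_add)
    qed
    show "\<exists>v\<in>normal_cone (X \<times> Y) u. \<exists>p\<in>normal_cone C u. g = v + p"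
      if "g \<in> normal_cone ((X \<times> Y) \<inter> C) u" for u g
      using that unfolding cone_sum by (auto simp: set_plus_def)
    obtain xb yb where "(0, 0) \<in> normal_cone ((X \<times> Y) \<inter> C) (xb, yb) + {D (xb, yb)}"
      using solvable unfolding A_eq cone_sum by blast
    then obtain g where "g \<in> normal_cone ((X \<times> Y) \<inter> C) (xb, yb)" "0 = g + D (xb, yb)"
      by (auto simp: set_plus_def zero_prod_def)
    then show "\<exists>u. - D u \<in> normal_cone ((X \<times> Y) \<inter> C) u"
      by (metis eq_neg_iff_add_eq_0)
  qed

  have z_eq: "z = avg"
    by (simp add: fun_eq_iff z \<tau> avg_def w_def)
  obtain xb yb where sol: "(xb, yb) \<in> solutions" and conv: "weakly_converges z (xb, yb)"
    using avg_weakly_converges unfolding z_eq by (metis surj_pair)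
  from sol have cone: "- D (xb, yb) \<in> normal_cone ((X \<inter> ?C1) \<times> (Y \<inter> ?C2)) (xb, yb)"
    by (simp add: solutions_def SC)
  \<comment> \<open>The optimality condition splits along the factors; the sign in the second
    component of \<open>D\<close> turns it into first-order optimality for a minimum in the first
    variable and a maximum in the second.\<close>
  then have cone1: "- grad1 f xb yb \<in> normal_cone (X \<inter> ?C1) xb"
    and cone2: "grad2 f xb yb \<in> normal_cone (Y \<inter> ?C2) yb"
    by (simp_all add: normal_cone_Times D)
  have f_at: "f differentiable (at (u, v))" for u v
    using f_diff by (simp add: differentiable_on_def)
  have "(\<lambda>u. f (u, yb)) differentiable (at xb)"
  proof (rule differentiable_compose[of f])
    show "f differentiable at (xb, yb)" by (rule f_at)
    show "(\<lambda>u. (u, yb)) differentiable at xb"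
      unfolding differentiable_def by (rule exI) (rule derivative_intros)+
  qed
  then have g1: "GDERIV (\<lambda>u. f (u, yb)) xb :> grad1 f xb yb"
    unfolding grad1_def by (rule GDERIV_grad)
  have "(\<lambda>v. f (xb, v)) differentiable (at yb)"
  proof (rule differentiable_compose[of f])
    show "f differentiable at (xb, yb)" by (rule f_at)
    show "(\<lambda>v. (xb, v)) differentiable at yb"
      unfolding differentiable_def by (rule exI) (rule derivative_intros)+
  qed
  then have g2: "GDERIV (\<lambda>v. f (xb, v)) yb :> grad2 f xb yb"
    unfolding grad2_def by (rule GDERIV_grad)
  have "saddle_point f {u \<in> X. K1 u = b} {v \<in> Y. K2 v = b'} xb yb"
    unfolding saddle_point_def
  proof (intro conjI ballI)
    show "xb \<in> {u \<in> X. K1 u = b}" "yb \<in> {v \<in> Y. K2 v = b'}"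
      using cone1 cone2 by (auto simp: normal_cone_def split: if_splits)
    show "f (xb, yb) \<le> f (u, yb)" if "u \<in> {u \<in> X. K1 u = b}" for u
    proof -
      have "0 \<le> inner (u - xb) (grad1 f xb yb)"
        using cone1 that by (auto simp: normal_cone_def split: if_splits)
      then show ?thesis
        using convex_on_gradient_inequality[OF f_convex g1, of u] by linarith
    qed
    show "f (xb, v) \<le> f (xb, yb)" if "v \<in> {v \<in> Y. K2 v = b'}" for v
    proof -
      have "inner (v - yb) (grad2 f xb yb) \<le> 0"
        using cone2 that by (auto simp: normal_cone_def split: if_splits)
      then show ?thesis
        using convex_on_gradient_inequality[OF _ GDERIV_minus[OF g2], of v] f_concave[of xb]
        by (simp add: concave_on_def)
    qed
  qed
  with conv show ?thesis by blast
qed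

end
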